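(* A Gaussian sequence $[x_k]=(x_0,\dots,x_N)$ of $\mathbb{R}^d$-valued vectors with covariance function $C_{l_1,l_2}=\mathrm{Cov}(x_{l_1},x_{l_2})$ is Markov if and only if $$C_{k,i}=C_{k,j}\,C_j^{+}\,C_{j,i}\qquad\text{for all } i,j,k\in[0,N]\text{ with } i<j<k,$$ where $C_j=C_{j,j}$ and the superscript $+$ denotes the Moore–Penrose inverse.
   Context: Sequences are indexed by discrete time $[0,N]=(0,1,\dots,N)$. A Gaussian sequence is jointly Gaussian, with possibly singular covariance. $[x_k]$ is Markov iff conditioned on the state at any time $k$, the segment before $k$ is independent of the segment after $k$; equivalently, $F(\xi_k|x_0,\dots,x_j)=F(\xi_k|x_j)$ (a.s.) for all $j<k$ in $[0,N]$ and all $\xi_k\in\mathbb{R}^d$, where $F(\cdot|\cdot)$ is the conditional CDF. *)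

theory Defs
  imports "HOL-Probability.Probability"
begin

definition moore_penrose :: "real^'n^'m \<Rightarrow> real^'m^'n \<Rightarrow> bool" where
  "moore_penrose A X \<longleftrightarrow>
     A ** X ** A = A \<and> X ** A ** X = X \<and>
     transpose (A ** X) = A ** X \<and> transpose (X ** A) = X ** A"

definition pinv :: "real^'n^'m \<Rightarrow> real^'m^'n" where
  "pinv A = (THE X. moore_penrose A X)"

lemma moore_penrose_unique:
  assumes X: "moore_penrose A X" and Y: "moore_penrose A Y"
  shows "X = Y"
proof -
  note x = X[unfolded moore_penrose_def] and y = Y[unfolded moore_penrose_def]
  have AXY: "A ** X = A ** Y"
  proof -
    have "A ** X = transpose (A ** Y ** (A ** X))"
      using x y by (simp add: matrix_mul_assoc)
    also have "\<dots> = A ** X ** (A ** Y)"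
      using x y by (simp add: matrix_transpose_mul)
    also have "\<dots> = A ** Y"
      using x by (simp add: matrix_mul_assoc)
    finally show ?thesis .
  qed
  have XYA: "X ** A = Y ** A"
  proof -
    have "X ** A = transpose (X ** A ** (Y ** A))"
      using x y by (metis matrix_mul_assoc)
    also have "\<dots> = Y ** A ** (X ** A)"
      using x y by (simp add: matrix_transpose_mul)
    also have "\<dots> = Y ** A"
      using x by (metis matrix_mul_assoc)
    finally show ?thesis .
  qed
  show ?thesis
    using AXY XYA x y by (metis matrix_mul_assoc)
qed

lemma moore_penrose_exists:
  fixes A :: "real^'n^'m"
  shows "\<exists>X. moore_penrose A X"
proof -
  define S where "S = transpose A ** A"
  have St: "transpose S = S"
    by (simp add: S_def matrix_transpose_mul)
  have Snull: "A *v z = 0" if "S *v z = 0" for z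
  proof -
    have "(A *v z) \<bullet> (A *v z) = (S *v z) \<bullet> z"
      unfolding S_def matrix_vector_mul_assoc[symmetric]
      by (simp add: dot_lmul_matrix flip: vector_transpose_matrix)
    then show ?thesis using that by simp
  qed
  have Sinj: "S *v x = 0" if "S *v (S *v x) = 0" for x
  proof -
    have "(S *v x) \<bullet> (S *v x) = x \<bullet> (S *v (S *v x))"
      by (metis St dot_lmul_matrix vector_transpose_matrix)
    then show ?thesis using that by simp
  qed
  let ?f = "\<lambda>v. S *v v"
  have sub: "subspace (range ?f)" "subspace (?f ` range ?f)"
    by (auto intro!: linear_subspace_image matrix_vector_mul_linear)
  have "inj_on ?f (span (range ?f))"
  proof (rule inj_onI)
    fix u v assume uv: "u \<in> span (range ?f)" "v \<in> span (range ?f)" "S *v u = S *v v"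
    then have "u - v \<in> range ?f"
      by (metis span_diff span_eq_iff sub(1))
    then obtain x where x: "u - v = S *v x" by auto
    have "S *v (S *v x) = 0"
      using uv by (simp flip: x add: matrix_vector_mult_diff_distrib)
    then have "u - v = 0" unfolding x by (rule Sinj)
    then show "u = v" by simp
  qed
  then have "dim (?f ` range ?f) = dim (range ?f)"
    by (intro dim_image_eq matrix_vector_mul_linear)
  then have "?f ` range ?f = range ?f"
    using sub by (intro subspace_dim_equal) auto
  then have "\<forall>x. \<exists>y. S *v x = S *v (S *v y)" by blast
  then obtain g where g: "\<And>x. S *v x = S *v (S *v g x)" by metis
  define B where "B = (\<chi> i j. g (axis j 1) $ i)"
  have colB: "column j B = g (axis j 1)" for j
    by (simp add: B_def column_def vec_eq_iff)
  have SSB: "S ** S ** B = S"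
  proof -
    have "column j (S ** S ** B) = column j S" for j
      using g[of "axis j 1"] colB[of j]
      by (metis matrix_vector_mul_assoc matrix_vector_mult_basis)
    then show ?thesis by (simp add: vec_eq_iff column_def)
  qed
  have BSS: "transpose B ** S ** S = S"
    using arg_cong[OF SSB, of transpose] St by (simp add: matrix_transpose_mul matrix_mul_assoc)
  define P where "P = S ** B"
  have P': "P = transpose B ** S"
    unfolding P_def using SSB BSS by (metis matrix_mul_assoc)
  have Pt: "transpose P = P"
    using St P' by (simp add: P_def matrix_transpose_mul)
  have PS: "P ** S = S"
    using BSS by (simp add: P')
  have SP: "S ** P = S"
    using SSB by (simp add: P_def matrix_mul_assoc)
  define G where "G = P ** B"
  have Gt: "transpose G = G"
    unfolding G_def P' using St by (simp add: matrix_transpose_mul matrix_mul_assoc)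
  have GS: "G ** S = P"
    using P' SP PS unfolding G_def P_def by (metis matrix_mul_assoc)
  have PG: "P ** G = G"
    unfolding G_def using PS P_def by (metis matrix_mul_assoc)
  have AP: "A ** P = A"
  proof -
    have "A *v (P *v v) = A *v v" for v
    proof -
      have "S *v (P *v v - v) = 0"
        by (simp add: matrix_vector_mult_diff_distrib matrix_vector_mul_assoc SP)
      from Snull[OF this] show ?thesis
        by (simp add: matrix_vector_mult_diff_distrib)
    qed
    then show ?thesis by (simp add: matrix_eq matrix_vector_mul_assoc[symmetric])
  qed
  have XA: "G ** transpose A ** A = P"
    using GS by (simp add: S_def matrix_mul_assoc)
  have "moore_penrose A (G ** transpose A)"
    unfolding moore_penrose_def
  proof (intro conjI)
    show "A ** (G ** transpose A) ** A = A"
      by (metis AP XA matrix_mul_assoc)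
    show "G ** transpose A ** A ** (G ** transpose A) = G ** transpose A"
      by (metis XA PG matrix_mul_assoc)
    show "transpose (A ** (G ** transpose A)) = A ** (G ** transpose A)"
      by (simp add: matrix_transpose_mul Gt matrix_mul_assoc)
    show "transpose (G ** transpose A ** A) = G ** transpose A ** A"
      by (simp add: XA Pt)
  qed
  then show ?thesis ..
qed

lemma moore_penrose_pinv: "moore_penrose A (pinv A)"
  unfolding pinv_def using moore_penrose_exists moore_penrose_unique by (metis theI)

definition covariance ::
    "'w measure \<Rightarrow> ('w \<Rightarrow> real^'m) \<Rightarrow> ('w \<Rightarrow> real^'n) \<Rightarrow> real^'n^'m" where
  "covariance M X Y =
     (\<chi> a b. \<integral>\<omega>. (X \<omega> - (\<integral>\<omega>. X \<omega> \<partial>M)) $ a * (Y \<omega> - (\<integral>\<omega>. Y \<omega> \<partial>M)) $ b \<partial>M)"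

(* normal_density m 0 is the zero function, so the degenerate case is a separate point mass. *)
definition normal_law :: "real \<Rightarrow> real \<Rightarrow> real measure" where
  "normal_law m s = (if s = 0 then return borel m else density lborel (normal_density m s))"

(* Joint Gaussianity, singular covariances allowed: every linear combination of all
   components of x 0, ..., x N is normal, possibly degenerate. *)
definition gaussian_sequence ::
    "'w measure \<Rightarrow> nat \<Rightarrow> (nat \<Rightarrow> 'w \<Rightarrow> real^'d) \<Rightarrow> bool" where
  "gaussian_sequence M N x \<longleftrightarrow>
     (\<forall>k\<le>N. x k \<in> borel_measurable M) \<and>
     (\<forall>a :: nat \<Rightarrow> real^'d. \<exists>m s. s \<ge> 0 \<and>
        distr M borel (\<lambda>\<omega>. \<Sum>k\<le>N. a k \<bullet> x k \<omega>) = normal_law m s)"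

definition cond_indep :: "'w measure \<Rightarrow> 'w measure \<Rightarrow> 'w measure \<Rightarrow> 'w measure \<Rightarrow> bool" where
  "cond_indep M F G H \<longleftrightarrow>
     (\<forall>A\<in>sets G. \<forall>B\<in>sets H. AE \<omega> in M.
        real_cond_exp M F (indicator (A \<inter> B)) \<omega> =
        real_cond_exp M F (indicator A) \<omega> * real_cond_exp M F (indicator B) \<omega>)"

(* The sigma-algebra generated by (x i) for i in I; it is trivial for I = {}. *)
definition segment_algebra ::
    "'w measure \<Rightarrow> (nat \<Rightarrow> 'w \<Rightarrow> real^'d) \<Rightarrow> nat set \<Rightarrow> 'w measure" where
  "segment_algebra M x I =
     vimage_algebra (space M) (\<lambda>\<omega>. \<lambda>i\<in>I. x i \<omega>) (PiM I (\<lambda>_. borel))"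

definition markov_sequence ::
    "'w measure \<Rightarrow> nat \<Rightarrow> (nat \<Rightarrow> 'w \<Rightarrow> real^'d) \<Rightarrow> bool" where
  "markov_sequence M N x \<longleftrightarrow>
     (\<forall>k\<le>N. cond_indep M (segment_algebra M x {k})
        (segment_algebra M x {..<k}) (segment_algebra M x {k<..N}))"

end

theory Submission
  imports Defs
begin

text \<open>
  The engine is a one-dimensional fact: if \<open>W\<close> is integrable and \<open>E[W exp(i t Z)] = 0\<close> for all \<open>t\<close>,
  then \<open>W\<close> is orthogonal to every event of \<open>Z\<close>, by Levy's uniqueness theorem applied to two positive
  densities whose difference is \<open>W\<close>. Treating one coordinate at a time extends this to finite
  families of vectors, so that uncorrelated linear statistics of a Gaussian sequence are independent
  although no multivariate uniqueness theorem is at hand.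

  The residual \<open>e = a \<bullet> x k - a \<bullet> C(k,j) C(j)\<^sup>+ x j\<close> is uncorrelated with \<open>x j\<close>, and the identity for
  \<open>i < j < k\<close> says exactly that it is uncorrelated with \<open>x i\<close> as well. If the sequence is Markov, the
  conditional defect \<open>1\<^sub>A - P(A | x j)\<close> of a past event \<open>A\<close> is orthogonal to present and future, hence to
  the centred residual; as that residual has mean zero given \<open>x j\<close>, it is orthogonal to \<open>A\<close> and so to
  \<open>x i\<close>. Conversely, under the identity the residuals are independent of past and present, and writing
  the future as residuals plus functions of \<open>x j\<close> shows that the Fourier transforms of the
  conditional defect against present and future vanish, which is the Markov property.
\<close>

section \<open>Vanishing of Fourier transforms\<close>

text \<open>Measurability into \<open>real^'d\<close> is tested against the basis vectors. This lets
  scalar coordinates, indexed by time and component, be regrouped into vectors.\<close>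

lemma borel_measurable_vec_coordinates:
  assumes "k \<in> J"
  shows "(\<lambda>y :: 'k \<times> 'd :: finite \<Rightarrow> real. (\<chi> i. y (k, i)) :: real^'d)
    \<in> borel_measurable (PiM (J \<times> UNIV) (\<lambda>_. borel))"
proof (rule borel_measurable_euclidean_space[THEN iffD2], intro ballI)
  fix b :: "real^'d" assume "b \<in> Basis"
  then obtain i where "b = axis i 1" by (auto simp: Basis_vec_def)
  then show "(\<lambda>y. (\<chi> i. y (k, i)) \<bullet> b) \<in> borel_measurable (PiM (J \<times> UNIV) (\<lambda>_. borel))"
    using assms by (simp add: inner_axis)
qed

context prob_space
begin

text \<open>Frequency zero gives \<open>W\<close> mean zero, so two positive functions with
  difference \<open>W\<close> have equal mass. Normalised, they reweight the law of \<open>Z\<close>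
  in two ways with equal characteristic functions, and Levy's theorem identifies the
  results.\<close>

lemma fourier_vanish_real:
  fixes W Z :: "'a \<Rightarrow> real"
  assumes W: "integrable M W" and [measurable]: "Z \<in> borel_measurable M"
    and vanish: "\<And>t. (\<integral>\<omega>. W \<omega> *\<^sub>R iexp (t * Z \<omega>) \<partial>M) = 0"
    and B[measurable]: "B \<in> sets borel"
  shows "(\<integral>\<omega>. indicator B (Z \<omega>) * W \<omega> \<partial>M) = 0"
proof -
  \<comment> \<open>The added 1 cancels in the difference and keeps the common mass \<open>c\<close>
    at least 1, so dividing by \<open>c\<close> is safe even if \<open>W\<close> vanishes almost
    everywhere.\<close>
  define P where "P \<omega> = max 0 (W \<omega>) + 1" for \<omega>
  define Q where "Q \<omega> = max 0 (- W \<omega>) + 1" for \<omega>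
  have [measurable]: "W \<in> borel_measurable M" using W by auto
  have PQ: "W \<omega> = P \<omega> - Q \<omega>" for \<omega> by (simp add: P_def Q_def)
  have int: "integrable M P" "integrable M Q"
    unfolding P_def[abs_def] Q_def[abs_def] using W by auto
  have pos: "P \<omega> > 0" "Q \<omega> > 0" for \<omega> by (simp_all add: P_def Q_def add_nonneg_pos)
  have c: "integral\<^sup>L M P = integral\<^sup>L M Q"
  proof -
    have "complex_of_real (integral\<^sup>L M W) = 0"
      using vanish[of 0] by (simp add: scaleR_conv_of_real)
    then have "integral\<^sup>L M W = 0" by simp
    then show ?thesis
      unfolding PQ[abs_def] using int by (subst (asm) Bochner_Integration.integral_diff) auto
  qed
  define c where "c = integral\<^sup>L M P"
  have c_pos: "c > 0"
  proof -
    have "integral\<^sup>L M (\<lambda>_. 1::real) \<le> c"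
      unfolding c_def using int by (intro integral_mono) (auto simp: P_def)
    then show ?thesis by (simp add: prob_space)
  qed
  \<comment> \<open>The law of \<open>Z\<close> under \<open>M\<close> reweighted by
    \<open>f / c\<close>, for general \<open>f\<close> so that \<open>P\<close> and \<open>Q\<close>
    share one argument.\<close>
  define \<mu> where "\<mu> f = distr (density M (\<lambda>\<omega>. ennreal (f \<omega> / c))) borel Z" for f :: "'a \<Rightarrow> real"
  have \<mu>: "real_distribution (\<mu> f)"
      "char (\<mu> f) t = (\<integral>\<omega>. (f \<omega> / c) *\<^sub>R iexp (t * Z \<omega>) \<partial>M)"
      "measure (\<mu> f) B = (\<integral>\<omega>. indicator B (Z \<omega>) * (f \<omega> / c) \<partial>M)"
    if f: "integrable M f" "\<And>\<omega>. f \<omega> > 0" "integral\<^sup>L M f = c" for f t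
  proof -
    have [measurable]: "f \<in> borel_measurable M" using f by auto
    have nn: "f \<omega> / c \<ge> 0" for \<omega> using f(2)[of \<omega>] c_pos by simp
    interpret D: prob_space "density M (\<lambda>\<omega>. ennreal (f \<omega> / c))"
    proof
      have "emeasure (density M (\<lambda>\<omega>. ennreal (f \<omega> / c))) (space M) = (\<integral>\<^sup>+\<omega>. ennreal (f \<omega> / c) \<partial>M)"
        by (simp add: emeasure_density)
      also have "\<dots> = ennreal (\<integral>\<omega>. f \<omega> / c \<partial>M)"
        using nn f by (intro nn_integral_eq_integral) auto
      also have "\<dots> = 1" using f c_pos by simp
      finally show "emeasure (density M (\<lambda>\<omega>. ennreal (f \<omega> / c)))
        (space (density M (\<lambda>\<omega>. ennreal (f \<omega> / c)))) = 1" by simp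
    qed
    show R: "real_distribution (\<mu> f)"
      unfolding \<mu>_def by (rule D.real_distribution_distr) simp
    show "char (\<mu> f) t = (\<integral>\<omega>. (f \<omega> / c) *\<^sub>R iexp (t * Z \<omega>) \<partial>M)"
      using nn unfolding char_def \<mu>_def
      by (subst integral_distr, simp, simp, subst integral_density) auto
    interpret R: real_distribution "\<mu> f" by (rule R)
    have "measure (\<mu> f) B = (\<integral>z. indicator B z \<partial>\<mu> f)" by simp
    also have "\<dots> = (\<integral>\<omega>. indicator B (Z \<omega>) * (f \<omega> / c) \<partial>M)"
      using nn unfolding \<mu>_def
      by (subst integral_distr, simp, simp, subst integral_density) (auto simp: mult.commute)
    finally show "measure (\<mu> f) B = (\<integral>\<omega>. indicator B (Z \<omega>) * (f \<omega> / c) \<partial>M)" .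
  qed
  have mP: "integral\<^sup>L M P = c" and mQ: "integral\<^sup>L M Q = c"
    using c by (simp_all add: c_def)
  have intc: "integrable M (\<lambda>\<omega>. (f \<omega> / c) *\<^sub>R iexp (t * Z \<omega>))" if "integrable M f" for f t
  proof (rule Bochner_Integration.integrable_bound)
    show "integrable M (\<lambda>\<omega>. f \<omega> / c)" using that by simp
    show "(\<lambda>\<omega>. (f \<omega> / c) *\<^sub>R iexp (t * Z \<omega>)) \<in> borel_measurable M"
      using borel_measurable_integrable[OF that] by measurable
  qed simp
  have "char (\<mu> P) t = char (\<mu> Q) t" for t
  proof -
    have "char (\<mu> P) t - char (\<mu> Q) t = (\<integral>\<omega>. (W \<omega> / c) *\<^sub>R iexp (t * Z \<omega>) \<partial>M)"
      unfolding \<mu>(2)[OF int(1) pos(1) mP] \<mu>(2)[OF int(2) pos(2) mQ]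
      by (subst Bochner_Integration.integral_diff[symmetric], (rule intc, rule int)+)
         (simp add: PQ diff_divide_distrib scaleR_diff_left)
    also have "\<dots> = (\<integral>\<omega>. (1 / c) *\<^sub>R (W \<omega> *\<^sub>R iexp (t * Z \<omega>)) \<partial>M)"
      by (simp add: scaleR_conv_of_real)
    also have "\<dots> = (1 / c) *\<^sub>R (\<integral>\<omega>. W \<omega> *\<^sub>R iexp (t * Z \<omega>) \<partial>M)"
      by (rule integral_scaleR_right)
    also have "\<dots> = 0" unfolding vanish by simp
    finally show ?thesis by simp
  qed
  then have eq: "\<mu> P = \<mu> Q"
    using \<mu>(1)[OF int(1) pos(1) mP] \<mu>(1)[OF int(2) pos(2) mQ]
    by (intro Levy_uniqueness) auto
  have intB: "integrable M (\<lambda>\<omega>. indicator B (Z \<omega>) * (f \<omega> / c))"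
    if "integrable M f" for f :: "'a \<Rightarrow> real"
  proof (rule Bochner_Integration.integrable_bound)
    show "integrable M (\<lambda>\<omega>. f \<omega> / c)" using that by simp
    show "(\<lambda>\<omega>. indicator B (Z \<omega>) * (f \<omega> / c)) \<in> borel_measurable M"
      using borel_measurable_integrable[OF that] by measurable
  qed (auto simp: indicator_def)
  have "0 = measure (\<mu> P) B - measure (\<mu> Q) B" by (simp add: eq)
  also have "\<dots> = (\<integral>\<omega>. indicator B (Z \<omega>) * (W \<omega> / c) \<partial>M)"
    unfolding \<mu>(3)[OF int(1) pos(1) mP] \<mu>(3)[OF int(2) pos(2) mQ]
    by (subst Bochner_Integration.integral_diff[symmetric], (rule intB, rule int)+)
       (simp add: PQ diff_divide_distrib right_diff_distrib)
  also have "\<dots> = (\<integral>\<omega>. (indicator B (Z \<omega>) * W \<omega>) / c \<partial>M)" by simp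
  also have "\<dots> = (\<integral>\<omega>. indicator B (Z \<omega>) * W \<omega> \<partial>M) / c" by (rule integral_divide_zero)
  finally show ?thesis using c_pos by simp
qed

text \<open>Complex weights arise once exponentials of other coordinates are absorbed into
  \<open>W\<close>. Conjugating the hypothesis at frequency \<open>- t\<close> gives it for the
  conjugate weight, hence for the real and imaginary parts.\<close>

lemma fourier_vanish:
  fixes W :: "'a \<Rightarrow> complex" and Z :: "'a \<Rightarrow> real"
  assumes W: "integrable M W" and [measurable]: "Z \<in> borel_measurable M"
    and vanish: "\<And>t. (\<integral>\<omega>. iexp (t * Z \<omega>) * W \<omega> \<partial>M) = 0"
    and B[measurable]: "B \<in> sets borel"
  shows "(\<integral>\<omega>. indicator B (Z \<omega>) *\<^sub>R W \<omega> \<partial>M) = 0"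
proof -
  have [measurable]: "W \<in> borel_measurable M" using W by auto
  have intW: "integrable M (\<lambda>\<omega>. iexp (t * Z \<omega>) * W \<omega>)" for t
    by (rule Bochner_Integration.integrable_bound[OF W]) (auto simp: norm_mult)
  have vanish': "(\<integral>\<omega>. iexp (t * Z \<omega>) * cnj (W \<omega>) \<partial>M) = 0" for t
  proof -
    have "(\<integral>\<omega>. iexp (t * Z \<omega>) * cnj (W \<omega>) \<partial>M) = (\<integral>\<omega>. cnj (iexp ((- t) * Z \<omega>) * W \<omega>) \<partial>M)"
      by (intro Bochner_Integration.integral_cong) (auto simp: exp_cnj)
    also have "\<dots> = cnj (\<integral>\<omega>. iexp ((- t) * Z \<omega>) * W \<omega> \<partial>M)"
      by (rule Bochner_Integration.integral_cnj)
    finally show ?thesis using vanish[of "- t"] by simp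
  qed
  have intW': "integrable M (\<lambda>\<omega>. iexp (t * Z \<omega>) * cnj (W \<omega>))" for t
  proof (rule Bochner_Integration.integrable_bound[OF W])
    have [measurable]: "(\<lambda>\<omega>. cnj (W \<omega>)) \<in> borel_measurable M"
      using W by (intro borel_measurable_integrable) simp
    show "(\<lambda>\<omega>. iexp (t * Z \<omega>) * cnj (W \<omega>)) \<in> borel_measurable M"
      by measurable
  qed (simp add: norm_mult)
  have Re: "(\<integral>\<omega>. Re (W \<omega>) *\<^sub>R iexp (t * Z \<omega>) \<partial>M) = 0" for t
  proof -
    have "Re (W \<omega>) *\<^sub>R iexp (t * Z \<omega>) =
        (iexp (t * Z \<omega>) * W \<omega> + iexp (t * Z \<omega>) * cnj (W \<omega>)) / 2" for \<omega>
      by (simp add: ring_distribs(1)[symmetric] complex_add_cnj scaleR_conv_of_real)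
    then show ?thesis using vanish[of t] vanish'[of t] intW[of t] intW'[of t] by (simp only: integral_divide_zero
      Bochner_Integration.integral_add Bochner_Integration.integral_diff) simp
  qed
  have Im: "(\<integral>\<omega>. Im (W \<omega>) *\<^sub>R iexp (t * Z \<omega>) \<partial>M) = 0" for t
  proof -
    have "Im (W \<omega>) *\<^sub>R iexp (t * Z \<omega>) =
        (iexp (t * Z \<omega>) * W \<omega> - iexp (t * Z \<omega>) * cnj (W \<omega>)) / (2 * \<i>)" for \<omega>
      by (simp only: right_diff_distrib[symmetric] complex_diff_cnj scaleR_conv_of_real) (simp add: mult_ac)
    then show ?thesis using vanish[of t] vanish'[of t] intW[of t] intW'[of t] by (simp only: integral_divide_zero
      Bochner_Integration.integral_add Bochner_Integration.integral_diff) simp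
  qed
  have intB: "integrable M (\<lambda>\<omega>. indicator B (Z \<omega>) *\<^sub>R W \<omega>)"
    by (rule Bochner_Integration.integrable_bound[OF W]) (auto simp: indicator_def)
  show ?thesis
  proof (rule complex_eqI)
    show "Re (\<integral>\<omega>. indicator B (Z \<omega>) *\<^sub>R W \<omega> \<partial>M) = Re 0"
      using fourier_vanish_real[of "\<lambda>\<omega>. Re (W \<omega>)" Z B] W Re by (simp add: integral_Re[OF intB, symmetric])
    show "Im (\<integral>\<omega>. indicator B (Z \<omega>) *\<^sub>R W \<omega> \<partial>M) = Im 0"
      using fourier_vanish_real[of "\<lambda>\<omega>. Im (W \<omega>)" Z B] W Im by (simp add: integral_Im[OF intB, symmetric])
  qed
qed

text \<open>Exponentials are traded for indicators one coordinate at a time. Each trade puts an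
  indicator into the weight, so the induction runs over all \<open>W\<close>.\<close>

lemma fourier_vanish_family:
  fixes W :: "'a \<Rightarrow> complex" and Z :: "'i \<Rightarrow> 'a \<Rightarrow> real"
  assumes "finite I" "integrable M W" "\<And>i. i \<in> I \<Longrightarrow> Z i \<in> borel_measurable M"
    and "\<And>s. (\<integral>\<omega>. iexp (\<Sum>i\<in>I. s i * Z i \<omega>) * W \<omega> \<partial>M) = 0"
    and "\<And>i. i \<in> I \<Longrightarrow> B i \<in> sets borel"
  shows "(\<integral>\<omega>. (\<Prod>i\<in>I. indicator (B i) (Z i \<omega>)) *\<^sub>R W \<omega> \<partial>M) = 0"
  using assms
proof (induction I arbitrary: W rule: finite_induct)
  case empty
  then show ?case by simp
next
  case (insert j I)
  have [measurable]: "Z j \<in> borel_measurable M" "B j \<in> sets borel" "W \<in> borel_measurable M"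
    using insert.prems by auto
  have mZ: "Z i \<in> borel_measurable M" if "i \<in> I" for i using that insert.prems by auto
  have [measurable]: "(\<lambda>\<omega>. \<Sum>i\<in>I. s i * Z i \<omega>) \<in> borel_measurable M" for s
    using mZ by (intro borel_measurable_sum borel_measurable_times) auto
  let ?V = "\<lambda>\<omega>. indicator (B j) (Z j \<omega>) *\<^sub>R W \<omega>"
  have V: "integrable M ?V"
    by (rule Bochner_Integration.integrable_bound[OF insert.prems(1)]) (auto simp: indicator_def)
  have "(\<integral>\<omega>. iexp (\<Sum>i\<in>I. s i * Z i \<omega>) * ?V \<omega> \<partial>M) = 0" for s
  proof -
    \<comment> \<open>With the frequencies \<open>s\<close> frozen, their exponential joins the
      weight and only coordinate \<open>j\<close> is treated. Its transform vanishes by the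
      hypothesis at \<open>s(j := t)\<close>.\<close>
    have "(\<integral>\<omega>. indicator (B j) (Z j \<omega>) *\<^sub>R (iexp (\<Sum>i\<in>I. s i * Z i \<omega>) * W \<omega>) \<partial>M) = 0"
    proof (rule fourier_vanish)
      show "integrable M (\<lambda>\<omega>. iexp (\<Sum>i\<in>I. s i * Z i \<omega>) * W \<omega>)"
        by (rule Bochner_Integration.integrable_bound[OF insert.prems(1)])
           (measurable, simp add: norm_mult del: of_real_sum)
      fix t
      have "(\<Sum>i\<in>insert j I. (s(j := t)) i * Z i \<omega>) = t * Z j \<omega> + (\<Sum>i\<in>I. s i * Z i \<omega>)" for \<omega>
      proof -
        have "(\<Sum>i\<in>I. (s(j := t)) i * Z i \<omega>) = (\<Sum>i\<in>I. s i * Z i \<omega>)"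
          using insert.hyps by (intro sum.cong) auto
        then show ?thesis using insert.hyps by simp
      qed
      then show "(\<integral>\<omega>. iexp (t * Z j \<omega>) * (iexp (\<Sum>i\<in>I. s i * Z i \<omega>) * W \<omega>) \<partial>M) = 0"
        using insert.prems(3)[of "s(j := t)"]
        by (simp add: distrib_left exp_add mult.assoc)
    qed auto
    then show ?thesis by simp
  qed
  from insert.IH[OF V mZ this] insert.prems(4)
  have "(\<integral>\<omega>. (\<Prod>i\<in>I. indicator (B i) (Z i \<omega>)) *\<^sub>R ?V \<omega> \<partial>M) = 0" by auto
  then show ?case using insert.hyps by (simp add: mult.commute)
qed

text \<open>Rectangles form an intersection-stable generator and are covered by the previous lemma.
  The sets with vanishing integral are closed under complements and countable disjoint
  unions.\<close>

lemma fourier_vanish_PiM: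
  fixes W :: "'a \<Rightarrow> complex" and Z :: "'i \<Rightarrow> 'a \<Rightarrow> real"
  assumes I: "finite I" and W: "integrable M W" and Z: "\<And>i. i \<in> I \<Longrightarrow> Z i \<in> borel_measurable M"
    and vanish: "\<And>s. (\<integral>\<omega>. iexp (\<Sum>i\<in>I. s i * Z i \<omega>) * W \<omega> \<partial>M) = 0"
    and S: "S \<in> sets (PiM I (\<lambda>_. borel :: real measure))"
  shows "(\<integral>\<omega>. indicator S (\<lambda>i\<in>I. Z i \<omega>) *\<^sub>R W \<omega> \<partial>M) = 0"
proof -
  let ?X = "\<lambda>\<omega>. \<lambda>i\<in>I. Z i \<omega>" and ?P = "PiM I (\<lambda>_. borel :: real measure)"
  have [measurable]: "?X \<in> measurable M ?P" using Z by (rule measurable_restrict)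
  have [measurable]: "W \<in> borel_measurable M" using W by auto
  have gen: "sets ?P = sigma_sets (\<Pi>\<^sub>E i\<in>I. space borel) (prod_algebra I (\<lambda>_. borel :: real measure))"
    by (rule sets_PiM)
  \<comment> \<open>Frequency zero settles the whole space, as the complement case requires.\<close>
  have EW: "integral\<^sup>L M W = 0" using vanish[of "\<lambda>_. 0"] by simp
  have int: "integrable M (\<lambda>\<omega>. indicator S (?X \<omega>) *\<^sub>R W \<omega>)" if [measurable]: "S \<in> sets ?P" for S
    by (rule Bochner_Integration.integrable_bound[OF W]) (auto simp: indicator_def)
  from S show ?thesis unfolding gen
  proof (induction rule: sigma_sets_induct_disjoint[OF Int_stable_prod_algebra prod_algebra_sets_into_space, consumes 1, case_names basic empty compl union])
    case (basic S)
    then obtain B where S: "S = (\<Pi>\<^sub>E i\<in>I. B i)" and B: "\<And>i. i \<in> I \<Longrightarrow> B i \<in> sets borel"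
      by (auto elim!: prod_algebraE_all)
    have "indicator S (?X \<omega>) = (\<Prod>i\<in>I. indicator (B i) (Z i \<omega>) :: real)" for \<omega>
    proof (cases "\<forall>i\<in>I. Z i \<omega> \<in> B i")
      case True
      then have "?X \<omega> \<in> S" by (auto simp: S)
      then show ?thesis using True by simp
    next
      case False
      then obtain i where i: "i \<in> I" "Z i \<omega> \<notin> B i" by auto
      then have "?X \<omega> \<notin> S" by (auto simp: S)
      moreover have "(\<Prod>i\<in>I. indicator (B i) (Z i \<omega>) :: real) = 0"
        using I i by (intro prod_zero bexI[of _ i]) auto
      ultimately show ?thesis by simp
    qed
    with fourier_vanish_family[OF I W Z vanish, of B] B show ?case by (simp only:)
  next
    case empty
    then show ?case by simp
  next
    case (compl S)
    then have [measurable]: "S \<in> sets ?P" by (simp add: gen)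
    have "(\<integral>\<omega>. indicator ((\<Pi>\<^sub>E i\<in>I. space borel) - S) (?X \<omega>) *\<^sub>R W \<omega> \<partial>M) =
        (\<integral>\<omega>. W \<omega> - indicator S (?X \<omega>) *\<^sub>R W \<omega> \<partial>M)"
      by (intro Bochner_Integration.integral_cong) (auto simp: indicator_def)
    also have "\<dots> = 0" unfolding Bochner_Integration.integral_diff[OF W int[OF \<open>S \<in> sets ?P\<close>]] EW compl(2) by simp
    finally show ?case .
  next
    case (union A)
    then have A[measurable]: "A n \<in> sets ?P" for n by (auto simp: gen)
    have disj: "disjoint_family (\<lambda>n. ?X -` A n \<inter> space M)"
      using union(1) by (auto simp: disjoint_family_on_def)
    have "(LINT \<omega>:(\<Union>n. ?X -` A n \<inter> space M)|M. W \<omega>) = (\<Sum>n. LINT \<omega>:(?X -` A n \<inter> space M)|M. W \<omega>)"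
    proof (rule lebesgue_integral_countable_add)
      show "set_integrable M (\<Union>n. ?X -` A n \<inter> space M) W"
        unfolding set_integrable_def using W by (intro integrable_mult_indicator) auto
      show "?X -` A i \<inter> space M \<inter> (?X -` A j \<inter> space M) = {}" if "i \<noteq> j" for i j
        using disj that by (auto simp: disjoint_family_on_def)
    qed measurable
    moreover have "(LINT \<omega>:(?X -` A n \<inter> space M)|M. W \<omega>) = 0" for n
      using union(3)[of n] unfolding set_lebesgue_integral_def
      by (subst (asm) Bochner_Integration.integral_cong) (auto simp: indicator_def)
    moreover have "(LINT \<omega>:(\<Union>n. ?X -` A n \<inter> space M)|M. W \<omega>) =
        (\<integral>\<omega>. indicator (\<Union>n. A n) (?X \<omega>) *\<^sub>R W \<omega> \<partial>M)"
      unfolding set_lebesgue_integral_def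
      by (intro Bochner_Integration.integral_cong) (auto simp: indicator_def)
    ultimately show ?case by (simp only: suminf_zero)
  qed
qed

text \<open>An event of the segment algebra is the preimage of a measurable set of vector tuples.
  Flattening the index to pairs of time and component turns the vector coefficients
  \<open>a k\<close> into scalar frequencies, so the product version applies.\<close>

lemma fourier_vanish_segment:
  fixes W :: "'a \<Rightarrow> complex" and x :: "nat \<Rightarrow> 'a \<Rightarrow> real^'d"
  assumes J: "finite J" and W: "integrable M W" and x: "\<And>k. k \<in> J \<Longrightarrow> x k \<in> borel_measurable M"
    and vanish: "\<And>a. (\<integral>\<omega>. iexp (\<Sum>k\<in>J. a k \<bullet> x k \<omega>) * W \<omega> \<partial>M) = 0"
    and D: "D \<in> sets (segment_algebra M x J)"
  shows "(\<integral>\<omega>. indicator D \<omega> *\<^sub>R W \<omega> \<partial>M) = 0"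
proof -
  let ?I = "J \<times> (UNIV :: 'd set)" and ?g = "\<lambda>y :: nat \<times> 'd \<Rightarrow> real. \<lambda>k\<in>J. \<chi> i. y (k, i)"
  let ?Z = "\<lambda>p \<omega>. x (fst p) \<omega> $ snd p"
  have g: "?g \<in> measurable (PiM ?I (\<lambda>_. borel)) (PiM J (\<lambda>_. borel))"
  proof (rule measurable_restrict)
    fix k assume k: "k \<in> J"
    then show "(\<lambda>y :: nat \<times> 'd \<Rightarrow> real. (\<chi> i. y (k, i)) :: real^'d) \<in> borel_measurable (PiM ?I (\<lambda>_. borel))"
      by (rule borel_measurable_vec_coordinates)
  qed
  have "(\<lambda>\<omega>. \<lambda>k\<in>J. x k \<omega>) \<in> space M \<rightarrow> space (PiM J (\<lambda>_. borel))"
    by (auto simp: space_PiM)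
  then obtain S where S: "S \<in> sets (PiM J (\<lambda>_. borel))" and DS: "D = (\<lambda>\<omega>. \<lambda>k\<in>J. x k \<omega>) -` S \<inter> space M"
    using D unfolding segment_algebra_def by (auto simp: sets_vimage_algebra2)
  let ?S = "?g -` S \<inter> space (PiM ?I (\<lambda>_. borel))"
  have S': "?S \<in> sets (PiM ?I (\<lambda>_. borel))"
    using g S by (rule measurable_sets)
  have gZ: "?g (\<lambda>p\<in>?I. ?Z p \<omega>) = (\<lambda>k\<in>J. x k \<omega>)" for \<omega>
    by (auto simp: fun_eq_iff vec_eq_iff)
  have "(\<integral>\<omega>. indicator ?S (\<lambda>p\<in>?I. ?Z p \<omega>) *\<^sub>R W \<omega> \<partial>M) = 0"
  proof (rule fourier_vanish_PiM[OF _ W _ _ S'])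
    show "finite ?I" using J by simp
    show "?Z p \<in> borel_measurable M" if "p \<in> ?I" for p
    proof -
      have "(\<lambda>\<omega>. x (fst p) \<omega> \<bullet> axis (snd p) 1) \<in> borel_measurable M"
        using x[of "fst p"] that by (intro borel_measurable_inner) (auto simp: mem_Times_iff)
      then show ?thesis by (simp add: inner_axis)
    qed
    fix s :: "nat \<times> 'd \<Rightarrow> real"
    have "(\<Sum>p\<in>?I. s p * ?Z p \<omega>) = (\<Sum>k\<in>J. (\<chi> i. s (k, i)) \<bullet> x k \<omega>)" for \<omega>
      by (simp add: inner_vec_def sum.cartesian_product split_beta)
    then show "(\<integral>\<omega>. iexp (\<Sum>p\<in>?I. s p * ?Z p \<omega>) * W \<omega> \<partial>M) = 0"
      using vanish[of "\<lambda>k. \<chi> i. s (k, i)"] by simp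
  qed
  moreover have "(\<integral>\<omega>. indicator ?S (\<lambda>p\<in>?I. ?Z p \<omega>) *\<^sub>R W \<omega> \<partial>M) = (\<integral>\<omega>. indicator D \<omega> *\<^sub>R W \<omega> \<partial>M)"
  proof (intro Bochner_Integration.integral_cong refl)
    fix \<omega> assume "\<omega> \<in> space M"
    have "(\<lambda>p\<in>?I. ?Z p \<omega>) \<in> ?S \<longleftrightarrow> ?g (\<lambda>p\<in>?I. ?Z p \<omega>) \<in> S"
      by (simp only: Int_iff vimage_eq) (simp add: space_PiM)
    also have "\<dots> \<longleftrightarrow> \<omega> \<in> D"
      unfolding gZ using \<open>\<omega> \<in> space M\<close> by (simp add: DS)
    finally have "(\<lambda>p\<in>?I. ?Z p \<omega>) \<in> ?S \<longleftrightarrow> \<omega> \<in> D" .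
    then show "indicator ?S (\<lambda>p\<in>?I. ?Z p \<omega>) *\<^sub>R W \<omega> = indicator D \<omega> *\<^sub>R W \<omega>"
      by (simp add: indicator_def)
  qed
  ultimately show ?thesis by simp
qed

end

section \<open>Segment algebras, normal laws and orthogonality\<close>

lemma space_segment_algebra [simp]: "space (segment_algebra M x I) = space M"
  by (simp add: segment_algebra_def)

lemma measurable_segment_algebra_component:
  fixes x :: "nat \<Rightarrow> 'w \<Rightarrow> real^'d"
  assumes "k \<in> I"
  shows "x k \<in> borel_measurable (segment_algebra M x I)"
proof -
  have "(\<lambda>\<omega>. \<lambda>i\<in>I. x i \<omega>) \<in> measurable (segment_algebra M x I) (PiM I (\<lambda>_. borel))"
    unfolding segment_algebra_def by (rule measurable_vimage_algebra1) (auto simp: space_PiM)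
  from measurable_compose[OF this measurable_component_singleton[OF assms]] show ?thesis
    using assms by simp
qed

text \<open>The segment algebra is the coarsest sigma-algebra on \<open>space M\<close> making the
  components measurable. Monotonicity in the index set and inclusion in \<open>M\<close> are
  instances.\<close>

lemma sets_segment_algebra_subset:
  fixes x :: "nat \<Rightarrow> 'w \<Rightarrow> real^'d"
  assumes "space F = space M" and "\<And>k. k \<in> I \<Longrightarrow> x k \<in> borel_measurable F"
  shows "sets (segment_algebra M x I) \<subseteq> sets F"
proof
  fix D assume "D \<in> sets (segment_algebra M x I)"
  moreover have "(\<lambda>\<omega>. \<lambda>i\<in>I. x i \<omega>) \<in> space M \<rightarrow> space (PiM I (\<lambda>_. borel))"
    by (auto simp: space_PiM)
  ultimately obtain S where "S \<in> sets (PiM I (\<lambda>_. borel))" "D = (\<lambda>\<omega>. \<lambda>i\<in>I. x i \<omega>) -` S \<inter> space F"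
    using assms(1) unfolding segment_algebra_def by (auto simp: sets_vimage_algebra2)
  moreover have "(\<lambda>\<omega>. \<lambda>i\<in>I. x i \<omega>) \<in> measurable F (PiM I (\<lambda>_. borel))"
    using assms(2) by (rule measurable_restrict)
  ultimately show "D \<in> sets F" using measurable_sets by blast
qed

lemma sets_segment_algebra_mono:
  fixes x :: "nat \<Rightarrow> 'w \<Rightarrow> real^'d"
  assumes "I \<subseteq> J"
  shows "sets (segment_algebra M x I) \<subseteq> sets (segment_algebra M x J)"
  using assms by (intro sets_segment_algebra_subset measurable_segment_algebra_component) auto

lemma subalgebra_segment_algebra:
  fixes x :: "nat \<Rightarrow> 'w \<Rightarrow> real^'d"
  assumes "\<And>k. k \<in> I \<Longrightarrow> x k \<in> borel_measurable M"
  shows "subalgebra M (segment_algebra M x I)"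
  using sets_segment_algebra_subset[of M M I x] assms by (simp add: subalgebra_def)

text \<open>Collects what is used of normal laws, the point mass at \<open>s = 0\<close> included.
  The characteristic function is needed only at frequency 1, since multiples of a linear combination
  are again linear combinations.\<close>

lemma normal_law_moments:
  assumes s: "s \<ge> 0"
  shows "integrable (normal_law m s) (\<lambda>z. z\<^sup>2)"
    and "(\<integral>z. z \<partial>normal_law m s) = m"
    and "(\<integral>z. (z - m)\<^sup>2 \<partial>normal_law m s) = s\<^sup>2"
    and "(\<integral>z. iexp z \<partial>normal_law m s) = iexp m * of_real (exp (- s\<^sup>2 / 2))"
proof -
  have "integrable (normal_law m s) (\<lambda>z. z\<^sup>2) \<and> (\<integral>z. z \<partial>normal_law m s) = m \<and>
    (\<integral>z. (z - m)\<^sup>2 \<partial>normal_law m s) = s\<^sup>2 \<and>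
    (\<integral>z. iexp z \<partial>normal_law m s) = iexp m * of_real (exp (- s\<^sup>2 / 2))"
  proof (cases "s = 0")
    case True
    then show ?thesis
      by (auto simp: normal_law_def integral_return integrable_iff_bounded nn_integral_return)
  next
    case False
    with s have pos: "s > 0" by simp
    have law: "normal_law m s = density lborel (normal_density m s)"
      using False by (simp add: normal_law_def)
    have "integrable lborel (\<lambda>z. normal_density m s z * z\<^sup>2)"
    proof -
      \<comment> \<open>Expanding about \<open>m\<close> reduces the second moment to the centred
        one, the mean and the total mass.\<close>
      have "integrable lborel (\<lambda>z. normal_density m s z * (z - m) ^ 2 +
          2 * m * (normal_density m s z * z) - m\<^sup>2 * normal_density m s z)"
        using integrable_normal_moment[OF pos, of m 2] integrable_normal_moment_nz_1[OF pos, of m]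
          integrable_normal_density[OF pos, of m] by simp
      then show ?thesis
        by (rule Bochner_Integration.integrable_cong[THEN iffD1, rotated -1])
           (auto simp: power2_eq_square algebra_simps)
    qed
    moreover have "(\<integral>z. (z - m)\<^sup>2 \<partial>normal_law m s) = s\<^sup>2"
      using integral_normal_moment_even[OF pos, of m 1] unfolding law
      by (subst integral_density) (auto simp: normal_density_nonneg)
    moreover have "(\<integral>z. z \<partial>normal_law m s) = m"
      using integral_normal_moment_nz_1[OF pos, of m] unfolding law
      by (subst integral_density) (auto simp: normal_density_nonneg)
    moreover have "(\<integral>z. iexp z \<partial>normal_law m s) = iexp m * of_real (exp (- s\<^sup>2 / 2))"
    proof -
      \<comment> \<open>The law is the image of the standard normal law under
        \<open>m + s * z\<close>, which reduces the claim to the standard characteristic function at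
        \<open>s\<close>.\<close>
      interpret S: prob_space std_normal_distribution
        by (rule prob_space_normal_density) simp
      have "distributed std_normal_distribution lborel (\<lambda>z. z) std_normal_density"
        unfolding distributed_def by (simp add: distr_id2)
      from S.normal_density_affine[OF this, of s m] pos
      have "distributed std_normal_distribution lborel (\<lambda>z. m + s * z) (normal_density m s)"
        by simp
      then have "normal_law m s = distr std_normal_distribution lborel (\<lambda>z. m + s * z)"
        unfolding law by (simp add: distributed_def)
      then have "(\<integral>z. iexp z \<partial>normal_law m s) = (\<integral>z. iexp (m + s * z) \<partial>std_normal_distribution)"
        by (simp add: integral_distr)
      also have "\<dots> = iexp m * char std_normal_distribution s"
        unfolding char_def by (simp add: distrib_left exp_add flip: integral_mult_right_zero)
      finally show ?thesis by (simp add: char_std_normal_distribution)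
    qed
    ultimately show ?thesis by (simp add: law integrable_density)
  qed
  then show "integrable (normal_law m s) (\<lambda>z. z\<^sup>2)"
    and "(\<integral>z. z \<partial>normal_law m s) = m"
    and "(\<integral>z. (z - m)\<^sup>2 \<partial>normal_law m s) = s\<^sup>2"
    and "(\<integral>z. iexp z \<partial>normal_law m s) = iexp m * of_real (exp (- s\<^sup>2 / 2))" by auto
qed

context prob_space
begin

lemma integrable_mult_square_integrable:
  fixes Y Z :: "'a \<Rightarrow> real"
  assumes [measurable]: "Y \<in> borel_measurable M" "Z \<in> borel_measurable M"
    and int: "integrable M (\<lambda>\<omega>. (Y \<omega>)\<^sup>2)" "integrable M (\<lambda>\<omega>. (Z \<omega>)\<^sup>2)"
  shows "integrable M (\<lambda>\<omega>. Y \<omega> * Z \<omega>)"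
proof (rule Bochner_Integration.integrable_bound)
  show "integrable M (\<lambda>\<omega>. (Y \<omega>)\<^sup>2 + (Z \<omega>)\<^sup>2)" using int by simp
  have "\<bar>a * b\<bar> \<le> a\<^sup>2 + b\<^sup>2" for a b :: real
  proof -
    have "0 \<le> (\<bar>a\<bar> - \<bar>b\<bar>)\<^sup>2" by simp
    then have "2 * (\<bar>a\<bar> * \<bar>b\<bar>) \<le> a\<^sup>2 + b\<^sup>2" by (simp add: power2_diff)
    moreover have "0 \<le> \<bar>a\<bar> * \<bar>b\<bar>" by simp
    ultimately show ?thesis unfolding abs_mult by linarith
  qed
  then show "AE \<omega> in M. norm (Y \<omega> * Z \<omega>) \<le> norm ((Y \<omega>)\<^sup>2 + (Z \<omega>)\<^sup>2)" by simp
qed simp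

text \<open>Orthogonality to all events of \<open>F\<close> means that the conditional expectation
  of \<open>V\<close> given \<open>F\<close> is zero almost everywhere. Pulling \<open>f\<close> out
  then passes from events to functions, and \<open>f\<close> may be unbounded.\<close>

lemma integral_mult_orthogonal:
  fixes f V :: "'a \<Rightarrow> real"
  assumes F: "subalgebra M F" and f: "f \<in> borel_measurable F"
    and V: "integrable M V" and fV: "integrable M (\<lambda>\<omega>. f \<omega> * V \<omega>)"
    and orth: "\<And>D. D \<in> sets F \<Longrightarrow> (\<integral>\<omega>. indicator D \<omega> * V \<omega> \<partial>M) = 0"
  shows "(\<integral>\<omega>. f \<omega> * V \<omega> \<partial>M) = 0"
proof -
  interpret finite_measure_subalgebra M F by unfold_locales (rule F)
  have [measurable]: "V \<in> borel_measurable M" "f \<in> borel_measurable M"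
    using V f measurable_from_subalg[OF F] by auto
  have "AE \<omega> in M. real_cond_exp M F V \<omega> = 0"
    using V orth by (intro real_cond_exp_charact) (auto simp: set_lebesgue_integral_def)
  then have "(\<integral>\<omega>. f \<omega> * real_cond_exp M F V \<omega> \<partial>M) = 0"
    by (intro integral_eq_zero_AE) auto
  then show ?thesis
    using real_cond_exp_intg(2)[OF fV f] by simp
qed

lemma integral_scaleR_orthogonal:
  fixes f :: "'a \<Rightarrow> real" and V :: "'a \<Rightarrow> complex"
  assumes F: "subalgebra M F" and f: "f \<in> borel_measurable F"
    and V: "integrable M V" and fV: "integrable M (\<lambda>\<omega>. f \<omega> *\<^sub>R V \<omega>)"
    and orth: "\<And>D. D \<in> sets F \<Longrightarrow> (\<integral>\<omega>. indicator D \<omega> *\<^sub>R V \<omega> \<partial>M) = 0"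
  shows "(\<integral>\<omega>. f \<omega> *\<^sub>R V \<omega> \<partial>M) = 0"
proof (rule complex_eqI)
  have int: "integrable M (\<lambda>\<omega>. indicator D \<omega> *\<^sub>R V \<omega>)" if "D \<in> sets F" for D
    using that F V by (intro integrable_mult_indicator) (auto simp: subalgebra_def)
  have "(\<integral>\<omega>. f \<omega> * Re (V \<omega>) \<partial>M) = 0"
  proof (rule integral_mult_orthogonal[OF F f])
    show "integrable M (\<lambda>\<omega>. f \<omega> * Re (V \<omega>))" using integrable_Re[OF fV] by simp
    show "(\<integral>\<omega>. indicator D \<omega> * Re (V \<omega>) \<partial>M) = 0" if "D \<in> sets F" for D
      using orth[OF that] integral_Re[OF int[OF that]] by simp
  qed (use V in simp)
  then show "Re (\<integral>\<omega>. f \<omega> *\<^sub>R V \<omega> \<partial>M) = Re 0" by (simp add: integral_Re[OF fV, symmetric])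
  have "(\<integral>\<omega>. f \<omega> * Im (V \<omega>) \<partial>M) = 0"
  proof (rule integral_mult_orthogonal[OF F f])
    show "integrable M (\<lambda>\<omega>. f \<omega> * Im (V \<omega>))" using integrable_Im[OF fV] by simp
    show "(\<integral>\<omega>. indicator D \<omega> * Im (V \<omega>) \<partial>M) = 0" if "D \<in> sets F" for D
      using orth[OF that] integral_Im[OF int[OF that]] by simp
  qed (use V in simp)
  then show "Im (\<integral>\<omega>. f \<omega> *\<^sub>R V \<omega> \<partial>M) = Im 0" by (simp add: integral_Im[OF fV, symmetric])
qed

end

section \<open>Gaussian sequences\<close>

text \<open>These are the combinations that \<open>gaussian_sequence\<close> makes normal, closed
  under linear operations. Constants are not adjoined, so means are subtracted explicitly
  later.\<close>

definition gaussian_span :: "nat \<Rightarrow> (nat \<Rightarrow> 'w \<Rightarrow> real^'d) \<Rightarrow> ('w \<Rightarrow> real) set" where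
  "gaussian_span N x = range (\<lambda>a \<omega>. \<Sum>k\<le>N. a k \<bullet> x k \<omega>)"

lemma gaussian_span_add:
  assumes "Y \<in> gaussian_span N x" "Z \<in> gaussian_span N x"
  shows "(\<lambda>\<omega>. Y \<omega> + Z \<omega>) \<in> gaussian_span N x"
proof -
  from assms obtain a b where "Y = (\<lambda>\<omega>. \<Sum>k\<le>N. a k \<bullet> x k \<omega>)" "Z = (\<lambda>\<omega>. \<Sum>k\<le>N. b k \<bullet> x k \<omega>)"
    by (auto simp: gaussian_span_def)
  then have "(\<lambda>\<omega>. Y \<omega> + Z \<omega>) = (\<lambda>\<omega>. \<Sum>k\<le>N. (a k + b k) \<bullet> x k \<omega>)"
    by (simp add: inner_add_left sum.distrib)
  then show ?thesis unfolding gaussian_span_def by (intro image_eqI[of _ _ "\<lambda>k. a k + b k"]) auto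
qed

lemma gaussian_span_scale:
  assumes "Z \<in> gaussian_span N x"
  shows "(\<lambda>\<omega>. t * Z \<omega>) \<in> gaussian_span N x"
proof -
  from assms obtain a where "Z = (\<lambda>\<omega>. \<Sum>k\<le>N. a k \<bullet> x k \<omega>)"
    by (auto simp: gaussian_span_def)
  then have "(\<lambda>\<omega>. t * Z \<omega>) = (\<lambda>\<omega>. \<Sum>k\<le>N. (t *\<^sub>R a k) \<bullet> x k \<omega>)"
    by (simp add: sum_distrib_left)
  then show ?thesis unfolding gaussian_span_def by (intro image_eqI[of _ _ "\<lambda>k. t *\<^sub>R a k"]) auto
qed

lemma gaussian_span_diff:
  assumes "Y \<in> gaussian_span N x" "Z \<in> gaussian_span N x"
  shows "(\<lambda>\<omega>. Y \<omega> - Z \<omega>) \<in> gaussian_span N x"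
  using gaussian_span_add[OF assms(1) gaussian_span_scale[OF assms(2), of "-1"]] by simp

lemma gaussian_span_component:
  assumes "k \<le> N"
  shows "(\<lambda>\<omega>. v \<bullet> x k \<omega>) \<in> gaussian_span N x"
proof -
  have "(\<Sum>j\<le>N. (if j = k then v else 0) \<bullet> x j \<omega>) = v \<bullet> x k \<omega>" for \<omega>
  proof -
    have "(\<Sum>j\<le>N. (if j = k then v else 0) \<bullet> x j \<omega>) = (\<Sum>j\<le>N. if j = k then v \<bullet> x j \<omega> else 0)"
      by (intro sum.cong) auto
    then show ?thesis using assms by simp
  qed
  then show ?thesis
    unfolding gaussian_span_def by (intro image_eqI[of _ _ "\<lambda>j. if j = k then v else 0"]) auto
qed

lemma gaussian_span_sum:
  assumes "finite J" "\<And>k. k \<in> J \<Longrightarrow> f k \<in> gaussian_span N x"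
  shows "(\<lambda>\<omega>. \<Sum>k\<in>J. f k \<omega>) \<in> gaussian_span N x"
  using assms
proof (induction J rule: finite_induct)
  case empty
  \<comment> \<open>Index 0 is always at most \<open>N\<close>, so the zero function is a
    combination.\<close>
  have "(\<lambda>\<omega>. 0 \<bullet> x 0 \<omega>) \<in> gaussian_span N x" by (rule gaussian_span_component) simp
  then show ?case by simp
next
  case (insert j J)
  then show ?case by (simp add: gaussian_span_add)
qed

section \<open>Scalar covariances on the Gaussian span\<close>

definition cov :: "'w measure \<Rightarrow> ('w \<Rightarrow> real) \<Rightarrow> ('w \<Rightarrow> real) \<Rightarrow> real" where
  "cov M Y Z = (\<integral>\<omega>. (Y \<omega> - integral\<^sup>L M Y) * (Z \<omega> - integral\<^sup>L M Z) \<partial>M)"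

lemma cov_commute: "cov M Y Z = cov M Z Y"
  by (simp add: cov_def mult.commute)

locale gaussian_process = prob_space M for M :: "'w measure" +
  fixes N :: nat and x :: "nat \<Rightarrow> 'w \<Rightarrow> real^'d"
  assumes gaussian: "gaussian_sequence M N x"
begin

lemma x_measurable: "k \<le> N \<Longrightarrow> x k \<in> borel_measurable M"
  using gaussian by (simp add: gaussian_sequence_def)

lemma span_measurable: "Z \<in> gaussian_span N x \<Longrightarrow> Z \<in> borel_measurable M"
  unfolding gaussian_span_def
  by (auto intro!: borel_measurable_sum borel_measurable_inner x_measurable)

lemma span_law:
  assumes "Z \<in> gaussian_span N x"
  obtains m s where "s \<ge> 0" "distr M borel Z = normal_law m s"
  using assms gaussian unfolding gaussian_sequence_def gaussian_span_def by blast

lemma span_square_integrable: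
  assumes Z: "Z \<in> gaussian_span N x"
  shows "integrable M (\<lambda>\<omega>. (Z \<omega>)\<^sup>2)"
proof -
  have [measurable]: "Z \<in> borel_measurable M" using Z by (rule span_measurable)
  obtain m s where ms: "s \<ge> 0" "distr M borel Z = normal_law m s"
    using Z by (rule span_law)
  show ?thesis
    using normal_law_moments(1)[OF ms(1), of m] unfolding ms(2)[symmetric]
    by (subst (asm) integrable_distr_eq) auto
qed

lemma span_integrable: "Z \<in> gaussian_span N x \<Longrightarrow> integrable M Z"
  by (rule square_integrable_imp_integrable[OF span_measurable span_square_integrable])

lemma span_mult_integrable:
  "Y \<in> gaussian_span N x \<Longrightarrow> Z \<in> gaussian_span N x \<Longrightarrow> integrable M (\<lambda>\<omega>. Y \<omega> * Z \<omega>)"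
  by (intro integrable_mult_square_integrable span_measurable span_square_integrable)

text \<open>The characteristic value depends on mean and variance alone; this is how zero covariance
  becomes independence.\<close>

lemma span_char:
  assumes Z: "Z \<in> gaussian_span N x"
  shows "(\<integral>\<omega>. iexp (Z \<omega>) \<partial>M) = iexp (integral\<^sup>L M Z) * of_real (exp (- cov M Z Z / 2))"
proof -
  have [measurable]: "Z \<in> borel_measurable M" using Z by (rule span_measurable)
  obtain m s where ms: "s \<ge> 0" "distr M borel Z = normal_law m s"
    using Z by (rule span_law)
  note mom = normal_law_moments[OF ms(1), of m, folded ms(2)]
  have m: "integral\<^sup>L M Z = m"
    using mom(2) by (subst (asm) integral_distr) auto
  have "cov M Z Z = s\<^sup>2"
    using mom(3) unfolding cov_def m by (subst (asm) integral_distr) (auto simp: power2_eq_square)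
  then show ?thesis
    using mom(4) unfolding m by (subst (asm) integral_distr) auto
qed

lemma cov_eq:
  assumes "Y \<in> gaussian_span N x" "Z \<in> gaussian_span N x"
  shows "cov M Y Z = (\<integral>\<omega>. Y \<omega> * Z \<omega> \<partial>M) - integral\<^sup>L M Y * integral\<^sup>L M Z"
proof -
  have "cov M Y Z = (\<integral>\<omega>. Y \<omega> * Z \<omega> - integral\<^sup>L M Z * Y \<omega> -
      integral\<^sup>L M Y * Z \<omega> + integral\<^sup>L M Y * integral\<^sup>L M Z \<partial>M)"
    unfolding cov_def by (intro Bochner_Integration.integral_cong) (auto simp: algebra_simps)
  also have "\<dots> = (\<integral>\<omega>. Y \<omega> * Z \<omega> \<partial>M) - integral\<^sup>L M Y * integral\<^sup>L M Z"
    using assms by (simp add: span_mult_integrable span_integrable prob_space)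
  finally show ?thesis .
qed

lemma cov_add_left:
  assumes "Y \<in> gaussian_span N x" "Y' \<in> gaussian_span N x" "Z \<in> gaussian_span N x"
  shows "cov M (\<lambda>\<omega>. Y \<omega> + Y' \<omega>) Z = cov M Y Z + cov M Y' Z"
proof -
  have "(\<integral>\<omega>. (Y \<omega> + Y' \<omega>) * Z \<omega> \<partial>M) = (\<integral>\<omega>. Y \<omega> * Z \<omega> \<partial>M) + (\<integral>\<omega>. Y' \<omega> * Z \<omega> \<partial>M)"
    unfolding distrib_right
    by (intro Bochner_Integration.integral_add span_mult_integrable assms)
  moreover have "(\<integral>\<omega>. Y \<omega> + Y' \<omega> \<partial>M) = integral\<^sup>L M Y + integral\<^sup>L M Y'"
    by (intro Bochner_Integration.integral_add span_integrable assms)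
  ultimately show ?thesis
    unfolding cov_eq[OF gaussian_span_add[OF assms(1,2)] assms(3)]
      cov_eq[OF assms(1,3)] cov_eq[OF assms(2,3)]
    by (simp add: distrib_right)
qed

lemma cov_scale_left:
  assumes "Y \<in> gaussian_span N x" "Z \<in> gaussian_span N x"
  shows "cov M (\<lambda>\<omega>. t * Y \<omega>) Z = t * cov M Y Z"
  unfolding cov_eq[OF gaussian_span_scale[OF assms(1)] assms(2)] cov_eq[OF assms]
  by (simp add: right_diff_distrib mult.assoc)

lemma cov_diff_left:
  assumes "Y \<in> gaussian_span N x" "Y' \<in> gaussian_span N x" "Z \<in> gaussian_span N x"
  shows "cov M (\<lambda>\<omega>. Y \<omega> - Y' \<omega>) Z = cov M Y Z - cov M Y' Z"
  using cov_add_left[OF assms(1) gaussian_span_scale[OF assms(2), of "-1"] assms(3)]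
    cov_scale_left[OF assms(2,3), of "-1"] by simp

lemma cov_sum_left:
  assumes "finite J" "\<And>k. k \<in> J \<Longrightarrow> f k \<in> gaussian_span N x" and Z: "Z \<in> gaussian_span N x"
  shows "cov M (\<lambda>\<omega>. \<Sum>k\<in>J. f k \<omega>) Z = (\<Sum>k\<in>J. cov M (f k) Z)"
  using assms(1,2)
proof (induction J rule: finite_induct)
  case empty
  show ?case by (simp add: cov_def)
next
  case (insert j J)
  have "cov M (\<lambda>\<omega>. f j \<omega> + (\<Sum>k\<in>J. f k \<omega>)) Z = cov M (f j) Z + cov M (\<lambda>\<omega>. \<Sum>k\<in>J. f k \<omega>) Z"
    using insert Z by (intro cov_add_left gaussian_span_sum) auto
  then show ?case using insert by simp
qed

text \<open>Without correlation both means and variances add, and the exponentials in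
  \<open>span_char\<close> turn these sums into products.\<close>

lemma char_uncorrelated:
  assumes Y: "Y \<in> gaussian_span N x" and Z: "Z \<in> gaussian_span N x" and YZ: "cov M Y Z = 0"
  shows "(\<integral>\<omega>. iexp (Y \<omega> + Z \<omega>) \<partial>M) = (\<integral>\<omega>. iexp (Y \<omega>) \<partial>M) * (\<integral>\<omega>. iexp (Z \<omega>) \<partial>M)"
proof -
  have YZ': "(\<lambda>\<omega>. Y \<omega> + Z \<omega>) \<in> gaussian_span N x" using Y Z by (rule gaussian_span_add)
  have "cov M (\<lambda>\<omega>. Y \<omega> + Z \<omega>) (\<lambda>\<omega>. Y \<omega> + Z \<omega>) = cov M Y Y + cov M Z Z"
    using cov_add_left[OF Y Z YZ'] cov_add_left[OF Y Z Y] cov_add_left[OF Y Z Z] YZ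
      cov_commute[of M Y "\<lambda>\<omega>. Y \<omega> + Z \<omega>"] cov_commute[of M Z "\<lambda>\<omega>. Y \<omega> + Z \<omega>"] cov_commute[of M Z Y]
    by linarith
  moreover have "integral\<^sup>L M (\<lambda>\<omega>. Y \<omega> + Z \<omega>) = integral\<^sup>L M Y + integral\<^sup>L M Z"
    using Y Z by (simp add: span_integrable)
  moreover have "iexp (a + b) * of_real (exp (- (c + d) / 2)) =
      iexp a * of_real (exp (- c / 2)) * (iexp b * of_real (exp (- d / 2)))" for a b c d
  proof -
    have "- (c + d) / 2 = - c / 2 + - d / 2" by (simp add: add_divide_distrib)
    then have "exp (- (c + d) / 2) = exp (- c / 2) * exp (- d / 2)" by (simp only: exp_add)
    moreover have "iexp (a + b) = iexp a * iexp b"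
      by (simp only: of_real_add distrib_left exp_add)
    ultimately show ?thesis by (simp only: of_real_mult mult_ac)
  qed
  ultimately show ?thesis
    unfolding span_char[OF YZ'] span_char[OF Y] span_char[OF Z] by (simp only:)
qed

lemma iexp_span_integrable:
  assumes "Z \<in> gaussian_span N x"
  shows "integrable M (\<lambda>\<omega>. iexp (Z \<omega>))"
proof (rule integrable_const_bound[of _ 1])
  have [measurable]: "Z \<in> borel_measurable M" using assms by (rule span_measurable)
  show "(\<lambda>\<omega>. iexp (Z \<omega>)) \<in> borel_measurable M" by measurable
qed simp

text \<open>By \<open>char_uncorrelated\<close>, \<open>iexp (Z \<omega>)\<close> minus its mean has
  vanishing transform against every combination over \<open>J\<close>. The conclusion expresses
  independence of \<open>Z\<close> from the events of \<open>J\<close>.\<close>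

lemma uncorrelated_char_orthogonal:
  assumes Z: "Z \<in> gaussian_span N x" and J: "J \<subseteq> {..N}"
    and unc: "\<And>i v. i \<in> J \<Longrightarrow> cov M Z (\<lambda>\<omega>. v \<bullet> x i \<omega>) = 0"
    and D: "D \<in> sets (segment_algebra M x J)"
  shows "(\<integral>\<omega>. indicator D \<omega> *\<^sub>R (iexp (Z \<omega>) - (\<integral>\<omega>. iexp (Z \<omega>) \<partial>M)) \<partial>M) = 0"
proof (rule fourier_vanish_segment[OF _ _ _ _ D])
  show fin: "finite J" using J finite_subset by blast
  show "integrable M (\<lambda>\<omega>. iexp (Z \<omega>) - (\<integral>\<omega>. iexp (Z \<omega>) \<partial>M))"
    using iexp_span_integrable[OF Z] by simp
  show "x k \<in> borel_measurable M" if "k \<in> J" for k using that J x_measurable by auto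
  fix b
  let ?Y = "\<lambda>\<omega>. \<Sum>k\<in>J. b k \<bullet> x k \<omega>" and ?c = "\<integral>\<omega>. iexp (Z \<omega>) \<partial>M"
  have sp: "(\<lambda>\<omega>. b k \<bullet> x k \<omega>) \<in> gaussian_span N x" if "k \<in> J" for k
    using that J by (auto intro: gaussian_span_component)
  have Y: "?Y \<in> gaussian_span N x" using fin sp by (rule gaussian_span_sum)
  have YZ: "(\<lambda>\<omega>. ?Y \<omega> + Z \<omega>) \<in> gaussian_span N x" using Y Z by (rule gaussian_span_add)
  have "cov M ?Y Z = 0"
    using unc by (subst cov_sum_left[OF fin sp Z]) (auto simp: cov_commute[where Z = Z])
  note char = char_uncorrelated[OF Y Z this]
  have "(\<integral>\<omega>. iexp (?Y \<omega>) * (iexp (Z \<omega>) - ?c) \<partial>M) = (\<integral>\<omega>. iexp (?Y \<omega> + Z \<omega>) - iexp (?Y \<omega>) * ?c \<partial>M)"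
    by (intro Bochner_Integration.integral_cong) (simp_all add: distrib_left exp_add right_diff_distrib)
  also have "\<dots> = (\<integral>\<omega>. iexp (?Y \<omega> + Z \<omega>) \<partial>M) - (\<integral>\<omega>. iexp (?Y \<omega>) * ?c \<partial>M)"
    by (intro Bochner_Integration.integral_diff integrable_mult_left impI iexp_span_integrable Y YZ)
  also have "(\<integral>\<omega>. iexp (?Y \<omega>) * ?c \<partial>M) = (\<integral>\<omega>. iexp (?Y \<omega>) \<partial>M) * ?c"
    by (rule integral_mult_left_zero)
  finally show "(\<integral>\<omega>. iexp (?Y \<omega>) * (iexp (Z \<omega>) - ?c) \<partial>M) = 0"
    unfolding char by simp
qed

text \<open>The previous lemma for all multiples \<open>t * Z\<close> is read with the roles
  exchanged: the centred indicator of \<open>D\<close> is now the weight and \<open>Z\<close> the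
  Fourier variable. Hence the weight is orthogonal to the events of \<open>Z\<close>, and then to
  \<open>Z\<close> itself.\<close>

lemma uncorrelated_mean_orthogonal:
  assumes Z: "Z \<in> gaussian_span N x" and J: "J \<subseteq> {..N}"
    and unc: "\<And>i v. i \<in> J \<Longrightarrow> cov M Z (\<lambda>\<omega>. v \<bullet> x i \<omega>) = 0"
    and D: "D \<in> sets (segment_algebra M x J)"
  shows "(\<integral>\<omega>. indicator D \<omega> * (Z \<omega> - integral\<^sup>L M Z) \<partial>M) = 0"
proof -
  have [measurable]: "Z \<in> borel_measurable M" using Z by (rule span_measurable)
  have "subalgebra M (segment_algebra M x J)"
    using J x_measurable by (intro subalgebra_segment_algebra) auto
  then have D'[measurable]: "D \<in> sets M" using D by (auto simp: subalgebra_def)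
  let ?W = "\<lambda>\<omega>. indicator D \<omega> - prob D"
  have W: "integrable M ?W" by (simp add: emeasure_eq_measure)
  have ZD: "integrable M (\<lambda>\<omega>. indicator D \<omega> * Z \<omega>)"
    using integrable_mult_indicator[OF D' span_integrable[OF Z]] by simp
  have "(\<integral>\<omega>. ?W \<omega> *\<^sub>R iexp (t * Z \<omega>) \<partial>M) = 0" for t
  proof -
    let ?f = "\<lambda>\<omega>. iexp (t * Z \<omega>)"
    have tZ: "(\<lambda>\<omega>. t * Z \<omega>) \<in> gaussian_span N x" using Z by (rule gaussian_span_scale)
    have f: "integrable M ?f" using tZ by (rule iexp_span_integrable)
    have "cov M (\<lambda>\<omega>. t * Z \<omega>) (\<lambda>\<omega>. v \<bullet> x i \<omega>) = 0" if i: "i \<in> J" for i v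
      using unc[OF i] Z i J by (subst cov_scale_left) (auto intro!: gaussian_span_component)
    from uncorrelated_char_orthogonal[OF tZ J this D]
    have *: "(\<integral>\<omega>. indicator D \<omega> *\<^sub>R (?f \<omega> - integral\<^sup>L M ?f) \<partial>M) = 0" .
    have fD: "integrable M (\<lambda>\<omega>. indicator D \<omega> *\<^sub>R ?f \<omega>)"
      using D' f by (rule integrable_mult_indicator)
    have cD: "integrable M (\<lambda>\<omega>. indicator D \<omega> *\<^sub>R integral\<^sup>L M ?f)"
      using D' by (intro integrable_mult_indicator) auto
    have "(\<integral>\<omega>. indicator D \<omega> *\<^sub>R ?f \<omega> \<partial>M) = (\<integral>\<omega>. indicator D \<omega> *\<^sub>R integral\<^sup>L M ?f \<partial>M)"
      using * unfolding scaleR_diff_right Bochner_Integration.integral_diff[OF fD cD] by simp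
    also have "\<dots> = prob D *\<^sub>R integral\<^sup>L M ?f"
      by (subst integral_scaleR_left) (auto simp: emeasure_eq_measure)
    finally have **: "(\<integral>\<omega>. indicator D \<omega> *\<^sub>R ?f \<omega> \<partial>M) = prob D *\<^sub>R integral\<^sup>L M ?f" .
    have "(\<integral>\<omega>. ?W \<omega> *\<^sub>R ?f \<omega> \<partial>M) =
        (\<integral>\<omega>. indicator D \<omega> *\<^sub>R ?f \<omega> \<partial>M) - (\<integral>\<omega>. prob D *\<^sub>R ?f \<omega> \<partial>M)"
      unfolding scaleR_diff_left using fD f
      by (intro Bochner_Integration.integral_diff integrable_scaleR_right) auto
    also have "(\<integral>\<omega>. prob D *\<^sub>R ?f \<omega> \<partial>M) = prob D *\<^sub>R integral\<^sup>L M ?f"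
      by (rule integral_scaleR_right)
    finally show ?thesis unfolding ** by simp
  qed
  note vanish = fourier_vanish_real[OF W \<open>Z \<in> borel_measurable M\<close> this]
  let ?F = "vimage_algebra (space M) Z borel"
  have "(\<integral>\<omega>. Z \<omega> * ?W \<omega> \<partial>M) = 0"
  proof (rule integral_mult_orthogonal[OF _ _ W])
    show "subalgebra M ?F"
      by (auto simp: subalgebra_def sets_vimage_algebra2)
    show "Z \<in> borel_measurable ?F" by (rule measurable_vimage_algebra1) simp
    show "integrable M (\<lambda>\<omega>. Z \<omega> * ?W \<omega>)"
      using ZD span_integrable[OF Z] by (simp add: right_diff_distrib mult.commute)
    fix E assume "E \<in> sets ?F"
    then obtain B where B: "B \<in> sets borel" "E = Z -` B \<inter> space M"
      by (auto simp: sets_vimage_algebra2)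
    have "(\<integral>\<omega>. indicator E \<omega> * ?W \<omega> \<partial>M) = (\<integral>\<omega>. indicator B (Z \<omega>) * ?W \<omega> \<partial>M)"
      by (intro Bochner_Integration.integral_cong) (auto simp: B indicator_def)
    then show "(\<integral>\<omega>. indicator E \<omega> * ?W \<omega> \<partial>M) = 0" using vanish[OF B(1)] by simp
  qed
  moreover have "(\<integral>\<omega>. Z \<omega> * ?W \<omega> \<partial>M) = (\<integral>\<omega>. indicator D \<omega> * Z \<omega> - prob D * Z \<omega> \<partial>M)"
    by (intro Bochner_Integration.integral_cong) (auto simp: algebra_simps)
  moreover have "\<dots> = (\<integral>\<omega>. indicator D \<omega> * Z \<omega> \<partial>M) - prob D * integral\<^sup>L M Z"
    using ZD span_integrable[OF Z] by simp
  moreover have "(\<integral>\<omega>. indicator D \<omega> * (Z \<omega> - integral\<^sup>L M Z) \<partial>M) =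
      (\<integral>\<omega>. indicator D \<omega> * Z \<omega> - indicator D \<omega> * integral\<^sup>L M Z \<partial>M)"
    by (simp add: right_diff_distrib)
  moreover have "\<dots> = (\<integral>\<omega>. indicator D \<omega> * Z \<omega> \<partial>M) - prob D * integral\<^sup>L M Z"
    using ZD by (subst Bochner_Integration.integral_diff) (auto simp: emeasure_eq_measure)
  ultimately show ?thesis by simp
qed

text \<open>Links the covariance matrices of the theorem to the scalar calculus by expansion in
  coordinates.\<close>

lemma cov_component:
  assumes k: "k \<le> N" and l: "l \<le> N"
  shows "cov M (\<lambda>\<omega>. v \<bullet> x k \<omega>) (\<lambda>\<omega>. w \<bullet> x l \<omega>) = v \<bullet> (covariance M (x k) (x l) *v w)"
proof -
  \<comment> \<open>\<open>covariance\<close> centres with the vector-valued mean, so the vectors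
    themselves must be integrable; the sum of absolute coordinates dominates the norm.\<close>
  have int: "integrable M (x k)" if "k \<le> N" for k
  proof (rule Bochner_Integration.integrable_bound)
    have "integrable M (\<lambda>\<omega>. x k \<omega> $ i)" for i
      using span_integrable[OF gaussian_span_component[OF that, of "axis i 1"]] by (simp add: inner_axis')
    then show "integrable M (\<lambda>\<omega>. \<Sum>i\<in>UNIV. \<bar>x k \<omega> $ i\<bar>)" by simp
    show "x k \<in> borel_measurable M" using that by (rule x_measurable)
    show "AE \<omega> in M. norm (x k \<omega>) \<le> norm (\<Sum>i\<in>UNIV. \<bar>x k \<omega> $ i\<bar>)"
      by (simp add: norm_le_l1_cart sum_nonneg)
  qed
  have mean: "(\<integral>\<omega>. u \<bullet> x k \<omega> \<partial>M) = u \<bullet> integral\<^sup>L M (x k)" if "k \<le> N" for u k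
    using int[OF that] by simp
  have comp: "integral\<^sup>L M (x k) $ i = (\<integral>\<omega>. x k \<omega> $ i \<partial>M)" if "k \<le> N" for i k
    using mean[OF that, of "axis i 1"] by (simp add: inner_axis')
  let ?f = "\<lambda>k a \<omega>. (x k \<omega> - integral\<^sup>L M (x k)) $ a"
  have f: "integrable M (\<lambda>\<omega>. ?f k a \<omega> * ?f l b \<omega>)" for a b
  proof -
    have c: "(\<lambda>\<omega>. x k \<omega> $ i) \<in> gaussian_span N x" if "k \<le> N" for k i
      using gaussian_span_component[OF that, of "axis i 1" x] by (simp add: inner_axis')
    have "integrable M (\<lambda>\<omega>. x k \<omega> $ a * x l \<omega> $ b - integral\<^sup>L M (x l) $ b * x k \<omega> $ a
        - integral\<^sup>L M (x k) $ a * x l \<omega> $ b + integral\<^sup>L M (x k) $ a * integral\<^sup>L M (x l) $ b)"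
      using k l c by (simp add: span_mult_integrable span_integrable)
    then show ?thesis by (simp add: algebra_simps)
  qed
  have "cov M (\<lambda>\<omega>. v \<bullet> x k \<omega>) (\<lambda>\<omega>. w \<bullet> x l \<omega>) =
      (\<integral>\<omega>. (v \<bullet> (x k \<omega> - integral\<^sup>L M (x k))) * (w \<bullet> (x l \<omega> - integral\<^sup>L M (x l))) \<partial>M)"
    unfolding cov_def mean[OF k] mean[OF l] inner_diff_right ..
  also have "\<dots> = (\<integral>\<omega>. (\<Sum>a\<in>UNIV. \<Sum>b\<in>UNIV. v $ a * (w $ b * (?f k a \<omega> * ?f l b \<omega>))) \<partial>M)"
    unfolding inner_vec_def sum_product by (simp add: mult_ac)
  also have "\<dots> = (\<Sum>a\<in>UNIV. \<Sum>b\<in>UNIV. v $ a * (w $ b * (\<integral>\<omega>. ?f k a \<omega> * ?f l b \<omega> \<partial>M)))"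
    using f by (simp add: Bochner_Integration.integral_sum del: vector_minus_component)
  also have "\<dots> = v \<bullet> (covariance M (x k) (x l) *v w)"
    unfolding inner_vec_def matrix_vector_mult_def covariance_def
    by (simp add: sum_distrib_left mult_ac)
  finally show ?thesis .
qed

section \<open>Regression on the present\<close>

text \<open>Zero variance makes \<open>Z\<close> equal to its mean almost everywhere.\<close>

lemma cov_degenerate:
  assumes Y: "Y \<in> gaussian_span N x" and Z: "Z \<in> gaussian_span N x" and ZZ: "cov M Z Z = 0"
  shows "cov M Y Z = 0"
proof -
  have int: "integrable M (\<lambda>\<omega>. (Z \<omega> - integral\<^sup>L M Z) * (Z \<omega> - integral\<^sup>L M Z))"
  proof -
    have "integrable M (\<lambda>\<omega>. Z \<omega> * Z \<omega> - 2 * integral\<^sup>L M Z * Z \<omega> + integral\<^sup>L M Z * integral\<^sup>L M Z)"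
      using span_mult_integrable[OF Z Z] span_integrable[OF Z] by simp
    then show ?thesis by (simp add: algebra_simps)
  qed
  have "AE \<omega> in M. (Z \<omega> - integral\<^sup>L M Z) * (Z \<omega> - integral\<^sup>L M Z) = 0"
    using integral_nonneg_eq_0_iff_AE[OF int] ZZ by (simp add: cov_def)
  then have "AE \<omega> in M. (Y \<omega> - integral\<^sup>L M Y) * (Z \<omega> - integral\<^sup>L M Z) = 0"
    by eventually_elim simp
  then show ?thesis unfolding cov_def by (rule integral_eq_zero_AE)
qed

text \<open>The covariance of \<open>x k\<close> with \<open>x j\<close> vanishes on the kernel of the covariance of \<open>x j\<close>,
  so the projection onto the range of the latter can be dropped.\<close>

lemma covariance_pinv_absorb:
  assumes k: "k \<le> N" and j: "j \<le> N"
  shows "covariance M (x k) (x j) ** pinv (covariance M (x j) (x j)) ** covariance M (x j) (x j) =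
    covariance M (x k) (x j)"
proof -
  let ?A = "covariance M (x k) (x j)" and ?C = "covariance M (x j) (x j)"
  have "?A *v w = ?A *v (pinv ?C *v (?C *v w))" for w
  proof -
    \<comment> \<open>The projection of \<open>w\<close> onto the kernel of
      \<open>?C\<close>.\<close>
    let ?u = "w - pinv ?C *v (?C *v w)"
    have "?C ** pinv ?C ** ?C = ?C"
      using moore_penrose_pinv[of ?C] by (simp add: moore_penrose_def)
    then have "?C *v ?u = 0"
      by (simp add: matrix_vector_mult_diff_distrib matrix_vector_mul_assoc matrix_mul_assoc)
    then have "cov M (\<lambda>\<omega>. ?u \<bullet> x j \<omega>) (\<lambda>\<omega>. ?u \<bullet> x j \<omega>) = 0"
      by (simp add: cov_component[OF j j])
    then have "cov M (\<lambda>\<omega>. v \<bullet> x k \<omega>) (\<lambda>\<omega>. ?u \<bullet> x j \<omega>) = 0" for v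
      by (rule cov_degenerate[OF gaussian_span_component[OF k] gaussian_span_component[OF j]])
    \<comment> \<open>With this \<open>v\<close> the covariance is the squared norm of
      \<open>?A *v ?u\<close>.\<close>
    from this[of "?A *v ?u"] have "?A *v ?u = 0"
      unfolding cov_component[OF k j] by (simp only: inner_eq_zero_iff)
    then show ?thesis by (simp add: matrix_vector_mult_diff_distrib)
  qed
  then show ?thesis by (simp add: matrix_eq matrix_vector_mul_assoc[symmetric])
qed

text \<open>The error of the linear regression of \<open>a \<bullet> x k\<close> on
  \<open>x j\<close>. The constant term is omitted, which keeps the error in
  \<open>gaussian_span\<close> but leaves it uncentred.\<close>

definition residual :: "nat \<Rightarrow> nat \<Rightarrow> real^'d \<Rightarrow> 'w \<Rightarrow> real" where
  "residual k j a \<omega> = a \<bullet> x k \<omega> -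
     (a v* (covariance M (x k) (x j) ** pinv (covariance M (x j) (x j)))) \<bullet> x j \<omega>"

lemma residual_span: "k \<le> N \<Longrightarrow> j \<le> N \<Longrightarrow> residual k j a \<in> gaussian_span N x"
  unfolding residual_def[abs_def] by (intro gaussian_span_diff gaussian_span_component)

text \<open>Makes the matrix identity a scalar one: it holds exactly when the right side vanishes
  for all \<open>a\<close> and \<open>v\<close>.\<close>

lemma cov_residual:
  assumes "k \<le> N" "j \<le> N" "i \<le> N"
  shows "cov M (residual k j a) (\<lambda>\<omega>. v \<bullet> x i \<omega>) = a \<bullet> (covariance M (x k) (x i) *v v) -
    a \<bullet> ((covariance M (x k) (x j) ** pinv (covariance M (x j) (x j)) ** covariance M (x j) (x i)) *v v)"
  unfolding residual_def[abs_def]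
    cov_diff_left[OF gaussian_span_component[OF assms(1)] gaussian_span_component[OF assms(2)]
      gaussian_span_component[OF assms(3)]]
    cov_component[OF assms(1,3)] cov_component[OF assms(2,3)]
  by (simp add: dot_lmul_matrix matrix_vector_mul_assoc)

text \<open>The normal equations of the regression; \<open>covariance_pinv_absorb\<close> secures
  them for singular covariances too.\<close>

lemma cov_residual_present:
  assumes "k \<le> N" "j \<le> N"
  shows "cov M (residual k j a) (\<lambda>\<omega>. v \<bullet> x j \<omega>) = 0"
  by (simp add: cov_residual assms covariance_pinv_absorb)

lemma subalgebra_segment: "I \<subseteq> {..N} \<Longrightarrow> subalgebra M (segment_algebra M x I)"
  by (intro subalgebra_segment_algebra x_measurable) auto

lemma component_measurable:
  "k \<in> I \<Longrightarrow> (\<lambda>\<omega>. v \<bullet> x k \<omega>) \<in> borel_measurable (segment_algebra M x I)"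
  by (intro borel_measurable_inner measurable_segment_algebra_component) auto

section \<open>Conditional probabilities and their defects\<close>

lemma cond_prob_bounds:
  assumes F: "subalgebra M F" and A: "A \<in> sets M"
  shows "AE \<omega> in M. 0 \<le> real_cond_exp M F (indicator A) \<omega> \<and> real_cond_exp M F (indicator A) \<omega> \<le> 1"
proof -
  interpret finite_measure_subalgebra M F by unfold_locales (rule F)
  have "integrable M (indicator A :: 'w \<Rightarrow> real)" using A by (simp add: emeasure_eq_measure)
  then show ?thesis
    using real_cond_exp_ge_c[of "indicator A" 0] real_cond_exp_le_c[of "indicator A" 1] by simp
qed

text \<open>The conditional expectation given \<open>F\<close> of this weight times the indicator of
  \<open>B\<close> is the failure of \<open>A\<close> and \<open>B\<close> to factor given
  \<open>F\<close>.\<close>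

definition cond_defect :: "'w measure \<Rightarrow> 'w set \<Rightarrow> 'w \<Rightarrow> real" where
  "cond_defect F A \<omega> = indicator A \<omega> - real_cond_exp M F (indicator A) \<omega>"

text \<open>A conditional probability lies between 0 and 1 almost everywhere, so multiplying by it
  preserves integrability.\<close>

lemma cond_defect_integrable:
  assumes F: "subalgebra M F" and A: "A \<in> sets M" and f: "integrable M f"
  shows "integrable M (\<lambda>\<omega>. f \<omega> * real_cond_exp M F (indicator A) \<omega>)"
    and "integrable M (\<lambda>\<omega>. f \<omega> * indicator A \<omega> :: real)"
    and "integrable M (\<lambda>\<omega>. f \<omega> * cond_defect F A \<omega>)"
proof -
  have [measurable]: "f \<in> borel_measurable M" "A \<in> sets M" using f A by auto
  show 1: "integrable M (\<lambda>\<omega>. f \<omega> * real_cond_exp M F (indicator A) \<omega>)"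
  proof (rule Bochner_Integration.integrable_bound[OF f])
    show "AE \<omega> in M. norm (f \<omega> * real_cond_exp M F (indicator A) \<omega>) \<le> norm (f \<omega>)"
      using cond_prob_bounds[OF F A] by eventually_elim (simp add: abs_mult mult_left_le)
  qed measurable
  show 2: "integrable M (\<lambda>\<omega>. f \<omega> * indicator A \<omega>)"
    using integrable_mult_indicator[OF A f] by (simp add: mult.commute)
  show "integrable M (\<lambda>\<omega>. f \<omega> * cond_defect F A \<omega>)"
    using 1 2 by (simp add: cond_defect_def right_diff_distrib)
qed

lemma cond_defect_orthogonal:
  assumes F: "subalgebra M F" and A: "A \<in> sets M"
    and f: "integrable M f" "f \<in> borel_measurable F"
  shows "(\<integral>\<omega>. f \<omega> * cond_defect F A \<omega> \<partial>M) = 0"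
proof -
  interpret finite_measure_subalgebra M F by unfold_locales (rule F)
  have "(\<integral>\<omega>. f \<omega> * real_cond_exp M F (indicator A) \<omega> \<partial>M) = (\<integral>\<omega>. f \<omega> * indicator A \<omega> \<partial>M)"
    using cond_defect_integrable(2)[OF F A f(1)] f(2) A by (intro real_cond_exp_intg(2)) auto
  then show ?thesis
    using cond_defect_integrable(1,2)[OF F A f(1)]
    by (simp add: cond_defect_def right_diff_distrib)
qed

text \<open>By \<open>cov_residual\<close> it suffices that the residual is uncorrelated with
  \<open>x i\<close>. The centred residual is shown orthogonal to the present, then to each past
  event, and finally to the past variable \<open>x i\<close>.\<close>

lemma markov_imp_covariance:
  assumes markov: "markov_sequence M N x" and ij: "i < j" and jk: "j < k" and k: "k \<le> N"
  shows "covariance M (x k) (x i) =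
    covariance M (x k) (x j) ** pinv (covariance M (x j) (x j)) ** covariance M (x j) (x i)"
proof -
  have j: "j \<le> N" and i: "i \<le> N" using ij jk k by auto
  let ?F = "segment_algebra M x {j}" and ?G = "segment_algebra M x {..<j}"
    and ?H = "segment_algebra M x {j<..N}"
  have F: "subalgebra M ?F" and G: "subalgebra M ?G" and H: "subalgebra M ?H"
    using j by (auto intro!: subalgebra_segment)
  interpret F: finite_measure_subalgebra M ?F by unfold_locales (rule F)
  have ci: "cond_indep M ?F ?G ?H" using markov j by (auto simp: markov_sequence_def)
  have "cov M (residual k j a) (\<lambda>\<omega>. c \<bullet> x i \<omega>) = 0" for a c
  proof -
    let ?e = "residual k j a"
    let ?e' = "\<lambda>\<omega>. ?e \<omega> - integral\<^sup>L M ?e"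
    have e: "?e \<in> gaussian_span N x" using k j by (rule residual_span)
    have e': "integrable M ?e'" using span_integrable[OF e] by simp
    have e'F: "(\<integral>\<omega>. indicator C \<omega> * ?e' \<omega> \<partial>M) = 0" if "C \<in> sets ?F" for C
      using e _ _ that
    proof (rule uncorrelated_mean_orthogonal)
      show "cov M ?e (\<lambda>\<omega>. v \<bullet> x l \<omega>) = 0" if "l \<in> {j}" for l v
        using that by (simp add: cov_residual_present k j)
    qed (use j in simp)
    have e'A: "(\<integral>\<omega>. indicator A \<omega> * ?e' \<omega> \<partial>M) = 0" if A: "A \<in> sets ?G" for A
    proof -
      have AM: "A \<in> sets M" using A G by (auto simp: subalgebra_def)
      let ?p = "real_cond_exp M ?F (indicator A)"
      \<comment> \<open>The one place where the Markov property enters. For an event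
        \<open>B\<close> of the future the conditional probability of the intersection factors, and
        pulling \<open>?p\<close> through the conditioning turns the factor for \<open>B\<close>
        back into its indicator.\<close>
      have future: "(\<integral>\<omega>. f \<omega> * cond_defect ?F A \<omega> \<partial>M) = 0"
        if f: "integrable M f" "f \<in> borel_measurable ?H" for f
      proof (rule integral_mult_orthogonal[OF H f(2)])
        show "integrable M (cond_defect ?F A)"
          using cond_defect_integrable(3)[OF F AM, of "\<lambda>_. 1"] by simp
        show "integrable M (\<lambda>\<omega>. f \<omega> * cond_defect ?F A \<omega>)"
          using F AM f(1) by (rule cond_defect_integrable(3))
        fix B assume B: "B \<in> sets ?H"
        then have BM: "B \<in> sets M" using H by (auto simp: subalgebra_def)
        have iB: "integrable M (indicator B :: 'w \<Rightarrow> real)" using BM by (simp add: emeasure_eq_measure)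
        note int = cond_defect_integrable[OF F AM iB]
        have "(\<integral>\<omega>. indicator B \<omega> * indicator A \<omega> \<partial>M) = (\<integral>\<omega>. indicator (A \<inter> B) \<omega> \<partial>M :: real)"
          by (intro Bochner_Integration.integral_cong) (auto simp: indicator_def)
        also have "\<dots> = (\<integral>\<omega>. real_cond_exp M ?F (indicator (A \<inter> B)) \<omega> \<partial>M)"
          using AM BM by (intro F.real_cond_exp_int(2)[symmetric]) (simp add: emeasure_eq_measure sets.Int)
        also have "\<dots> = (\<integral>\<omega>. ?p \<omega> * real_cond_exp M ?F (indicator B) \<omega> \<partial>M)"
          using ci A B by (intro integral_cong_AE) (auto simp: cond_indep_def)
        also have "\<dots> = (\<integral>\<omega>. ?p \<omega> * indicator B \<omega> \<partial>M)"
          using int(1) BM by (intro F.real_cond_exp_intg(2)) (auto simp: mult.commute)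
        finally show "(\<integral>\<omega>. indicator B \<omega> * cond_defect ?F A \<omega> \<partial>M) = 0"
          using int(1,2) by (simp add: cond_defect_def right_diff_distrib mult.commute)
      qed
      let ?b = "a v* (covariance M (x k) (x j) ** pinv (covariance M (x j) (x j)))"
      let ?m = "integral\<^sup>L M ?e" and ?W = "cond_defect ?F A"
      have ints: "integrable M (\<lambda>\<omega>. a \<bullet> x k \<omega>)" "integrable M (\<lambda>\<omega>. ?b \<bullet> x j \<omega> + ?m)"
        using span_integrable[OF gaussian_span_component[OF k]]
          span_integrable[OF gaussian_span_component[OF j]] by auto
      have "(\<integral>\<omega>. (a \<bullet> x k \<omega>) * ?W \<omega> \<partial>M) = 0"
        using ints(1) jk k by (intro future component_measurable) auto
      moreover have "(\<integral>\<omega>. (?b \<bullet> x j \<omega> + ?m) * ?W \<omega> \<partial>M) = 0"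
        using ints(2) component_measurable[of j "{j}"]
        by (intro cond_defect_orthogonal[OF F AM]) auto
      \<comment> \<open>The centred residual is a future term minus a present one; the constant mean
        counts as present.\<close>
      moreover have "?e' \<omega> * ?W \<omega> = (a \<bullet> x k \<omega>) * ?W \<omega> - (?b \<bullet> x j \<omega> + ?m) * ?W \<omega>" for \<omega>
        by (simp add: residual_def algebra_simps)
      ultimately have eW: "(\<integral>\<omega>. ?e' \<omega> * ?W \<omega> \<partial>M) = 0"
        using cond_defect_integrable(3)[OF F AM] ints by (simp only: Bochner_Integration.integral_diff)
      \<comment> \<open>\<open>?p\<close> is measurable in the present, so \<open>e'F\<close>
        applies. Together with \<open>eW\<close> this leaves only the indicator of
        \<open>A\<close>.\<close>
      have "(\<integral>\<omega>. ?p \<omega> * ?e' \<omega> \<partial>M) = 0"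
        using cond_defect_integrable(1)[OF F AM e']
        by (intro integral_mult_orthogonal[OF F _ e' _ e'F]) (auto simp: mult.commute)
      then have "(\<integral>\<omega>. ?e' \<omega> * ?p \<omega> \<partial>M) = 0" by (simp only: mult.commute)
      moreover have "(\<integral>\<omega>. ?e' \<omega> * ?W \<omega> \<partial>M) = (\<integral>\<omega>. ?e' \<omega> * indicator A \<omega> \<partial>M) - (\<integral>\<omega>. ?e' \<omega> * ?p \<omega> \<partial>M)"
        unfolding cond_defect_def right_diff_distrib[of "?e' _"]
        by (intro Bochner_Integration.integral_diff cond_defect_integrable(1,2)[OF F AM e'])
      ultimately have "(\<integral>\<omega>. ?e' \<omega> * indicator A \<omega> \<partial>M) = 0" using eW by simp
      then show ?thesis by (simp only: mult.commute)
    qed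
    let ?Z = "\<lambda>\<omega>. c \<bullet> x i \<omega>"
    have Z: "?Z \<in> gaussian_span N x" using i by (rule gaussian_span_component)
    have "(\<integral>\<omega>. (?Z \<omega> - integral\<^sup>L M ?Z) * ?e' \<omega> \<partial>M) = 0"
    proof (rule integral_mult_orthogonal[OF G _ e' _ e'A])
      show "(\<lambda>\<omega>. ?Z \<omega> - integral\<^sup>L M ?Z) \<in> borel_measurable ?G"
        using component_measurable[of i "{..<j}" c] ij by simp
      have "integrable M (\<lambda>\<omega>. ?Z \<omega> * ?e \<omega> - integral\<^sup>L M ?e * ?Z \<omega> - integral\<^sup>L M ?Z * ?e' \<omega>)"
        using span_mult_integrable[OF Z e] span_integrable[OF Z] e' 
        by (intro Bochner_Integration.integrable_diff[OF Bochner_Integration.integrable_diff]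
            integrable_mult_right impI)
      then show "integrable M (\<lambda>\<omega>. (?Z \<omega> - integral\<^sup>L M ?Z) * ?e' \<omega>)"
        by (simp only: algebra_simps)
    qed
    then show ?thesis unfolding cov_def by (simp only: mult.commute)
  qed
  then have "a \<bullet> (covariance M (x k) (x i) *v c) =
      a \<bullet> ((covariance M (x k) (x j) ** pinv (covariance M (x j) (x j)) ** covariance M (x j) (x i)) *v c)" for a c
    using cov_residual[OF k j i] by simp
  then show ?thesis unfolding matrix_eq using vector_eq_ldot by blast
qed

text \<open>The defect of a past event is shown to integrate to zero over every event of present and
  future jointly. The present is included because conditional expectations given \<open>x j\<close>
  are tested on its events.\<close>

lemma covariance_imp_markov:
  assumes identity: "\<And>i j k. i < j \<Longrightarrow> j < k \<Longrightarrow> k \<le> N \<Longrightarrow> covariance M (x k) (x i) =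
    covariance M (x k) (x j) ** pinv (covariance M (x j) (x j)) ** covariance M (x j) (x i)"
  shows "markov_sequence M N x"
  unfolding markov_sequence_def cond_indep_def
proof (intro allI impI ballI)
  fix j A B
  assume j: "j \<le> N" and A: "A \<in> sets (segment_algebra M x {..<j})"
    and B: "B \<in> sets (segment_algebra M x {j<..N})"
  let ?F = "segment_algebra M x {j}" and ?G = "segment_algebra M x {..<j}"
    and ?H = "segment_algebra M x {j<..N}" and ?P = "segment_algebra M x {..j}"
  have F: "subalgebra M ?F" and G: "subalgebra M ?G" and H: "subalgebra M ?H" and P: "subalgebra M ?P"
    using j by (auto intro!: subalgebra_segment)
  interpret F: finite_measure_subalgebra M ?F by unfold_locales (rule F)
  have AM: "A \<in> sets M" and BM: "B \<in> sets M" using A G B H by (auto simp: subalgebra_def)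
  let ?W = "cond_defect ?F A" and ?p = "real_cond_exp M ?F (indicator A)"
  have W: "integrable M ?W"
    using cond_defect_integrable(3)[OF F AM, of "\<lambda>_. 1"] by simp
  \<comment> \<open>The defect depends on past and present only, from which the residuals of the
    future will be independent.\<close>
  have WP: "?W \<in> borel_measurable ?P"
  proof -
    have "A \<in> sets ?P" by (rule subsetD[OF sets_segment_algebra_mono A]) auto
    moreover have "?p \<in> borel_measurable ?P"
      using sets_segment_algebra_mono[of "{j}" "{..j}" M x]
      by (intro measurable_from_subalg[of ?P ?F]) (auto simp: subalgebra_def)
    ultimately show ?thesis unfolding cond_defect_def[abs_def] by measurable
  qed
  have char: "(\<integral>\<omega>. iexp (\<Sum>k\<in>{j..N}. a k \<bullet> x k \<omega>) * complex_of_real (?W \<omega>) \<partial>M) = 0" for a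
  proof -
    \<comment> \<open>Each future component is its residual plus its regression on
      \<open>x j\<close>: \<open>d\<close> gathers the coefficients of \<open>x j\<close>, and
      \<open>Z\<close> the residuals.\<close>
    define d where "d = a j + (\<Sum>k\<in>{j<..N}. a k v* (covariance M (x k) (x j) ** pinv (covariance M (x j) (x j))))"
    define Z where "Z \<omega> = (\<Sum>k\<in>{j<..N}. residual k j (a k) \<omega>)" for \<omega>
    let ?V = "\<lambda>\<omega>. iexp (Z \<omega>) - (\<integral>\<omega>. iexp (Z \<omega>) \<partial>M)"
    have split: "(\<Sum>k\<in>{j..N}. a k \<bullet> x k \<omega>) = d \<bullet> x j \<omega> + Z \<omega>" for \<omega>
    proof -
      have "{j..N} = insert j {j<..N}" using j by auto
      then have "(\<Sum>k\<in>{j..N}. a k \<bullet> x k \<omega>) = a j \<bullet> x j \<omega> + (\<Sum>k\<in>{j<..N}. a k \<bullet> x k \<omega>)" by simp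
      then show ?thesis
        by (simp add: Z_def d_def residual_def inner_add_left inner_sum_left sum_subtractf)
    qed
    have res: "residual k j (a k) \<in> gaussian_span N x" if "k \<in> {j<..N}" for k
      using that j by (intro residual_span) auto
    have Z: "Z \<in> gaussian_span N x"
      unfolding Z_def[abs_def] using res by (intro gaussian_span_sum) auto
    have "cov M Z (\<lambda>\<omega>. v \<bullet> x i \<omega>) = 0" if i: "i \<in> {..j}" for i v
    proof -
      have "cov M (residual k j (a k)) (\<lambda>\<omega>. v \<bullet> x i \<omega>) = 0" if k: "k \<in> {j<..N}" for k
      \<comment> \<open>The present is handled by the normal equations; the assumed identity is
        needed for the strict past.\<close>
      proof (cases "i = j")
        case True
        then show ?thesis using k j cov_residual_present by simp
      next
        case False
        then show ?thesis using k j i identity[of i j k] by (simp add: cov_residual)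
      qed
      moreover have "(\<lambda>\<omega>. v \<bullet> x i \<omega>) \<in> gaussian_span N x"
        using i j by (intro gaussian_span_component) auto
      ultimately show ?thesis
        unfolding Z_def[abs_def] by (subst cov_sum_left) (auto simp: res)
    qed
    then have orth: "(\<integral>\<omega>. indicator D \<omega> *\<^sub>R ?V \<omega> \<partial>M) = 0" if "D \<in> sets ?P" for D
      using Z j that by (intro uncorrelated_char_orthogonal) auto
    have V: "integrable M ?V" using iexp_span_integrable[OF Z] by simp
    have [measurable]: "Z \<in> borel_measurable M" using Z by (rule span_measurable)
    \<comment> \<open>\<open>g\<close> will be \<open>cos\<close> and \<open>sin\<close>, since
      \<open>integral_scaleR_orthogonal\<close> takes a real factor. That factor depends on past and
      present, so \<open>iexp (Z \<omega>)\<close> may be replaced by its mean, and what remains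
      vanishes because the defect is orthogonal to functions of the present.\<close>
    have real_case: "(\<integral>\<omega>. (?W \<omega> * g (d \<bullet> x j \<omega>)) *\<^sub>R iexp (Z \<omega>) \<partial>M) = 0"
      "integrable M (\<lambda>\<omega>. (?W \<omega> * g (d \<bullet> x j \<omega>)) *\<^sub>R iexp (Z \<omega>))"
      if g[measurable]: "g \<in> borel_measurable borel" and g_le: "\<And>t. \<bar>g t\<bar> \<le> 1" for g :: "real \<Rightarrow> real"
    proof -
      have gF: "(\<lambda>\<omega>. g (d \<bullet> x j \<omega>)) \<in> borel_measurable ?F"
        using component_measurable[of j "{j}" d] by simp
      have gP: "(\<lambda>\<omega>. g (d \<bullet> x j \<omega>)) \<in> borel_measurable ?P"
        using component_measurable[of j "{..j}" d] by simp
      have gM: "(\<lambda>\<omega>. g (d \<bullet> x j \<omega>)) \<in> borel_measurable M"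
        using F gF by (rule measurable_from_subalg)
      have gi: "integrable M (\<lambda>\<omega>. g (d \<bullet> x j \<omega>))"
        using gM g_le by (intro integrable_const_bound[of _ 1]) auto
      let ?f = "\<lambda>\<omega>. ?W \<omega> * g (d \<bullet> x j \<omega>)"
      have f: "integrable M ?f"
        using cond_defect_integrable(3)[OF F AM gi] by (simp add: mult.commute)
      have f0: "(\<integral>\<omega>. ?f \<omega> \<partial>M) = 0"
        using cond_defect_orthogonal[OF F AM gi gF] by (simp add: mult.commute)
      show fZ: "integrable M (\<lambda>\<omega>. ?f \<omega> *\<^sub>R iexp (Z \<omega>))"
      proof (rule Bochner_Integration.integrable_bound[OF f])
        show "(\<lambda>\<omega>. ?f \<omega> *\<^sub>R iexp (Z \<omega>)) \<in> borel_measurable M"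
          using borel_measurable_integrable[OF f] by measurable
      qed simp
      have fc: "integrable M (\<lambda>\<omega>. ?f \<omega> *\<^sub>R (\<integral>\<omega>. iexp (Z \<omega>) \<partial>M))"
        using f by (intro integrable_scaleR_left)
      have "(\<integral>\<omega>. ?f \<omega> *\<^sub>R ?V \<omega> \<partial>M) = 0"
      proof (rule integral_scaleR_orthogonal[OF P _ V _ orth])
        show "?f \<in> borel_measurable ?P" using WP gP by measurable
        show "integrable M (\<lambda>\<omega>. ?f \<omega> *\<^sub>R ?V \<omega>)"
          unfolding scaleR_diff_right using fZ fc by (rule Bochner_Integration.integrable_diff)
      qed
      moreover have "(\<integral>\<omega>. ?f \<omega> *\<^sub>R (\<integral>\<omega>. iexp (Z \<omega>) \<partial>M) \<partial>M) = 0"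
        using f f0 by (subst integral_scaleR_left) auto
      ultimately show "(\<integral>\<omega>. ?f \<omega> *\<^sub>R iexp (Z \<omega>) \<partial>M) = 0"
        unfolding scaleR_diff_right Bochner_Integration.integral_diff[OF fZ fc] by simp
    qed
    have "iexp (d \<bullet> x j \<omega> + Z \<omega>) * complex_of_real (?W \<omega>) =
        (?W \<omega> * cos (d \<bullet> x j \<omega>)) *\<^sub>R iexp (Z \<omega>) + \<i> * ((?W \<omega> * sin (d \<bullet> x j \<omega>)) *\<^sub>R iexp (Z \<omega>))" for \<omega>
    proof -
      have "iexp (d \<bullet> x j \<omega> + Z \<omega>) = iexp (d \<bullet> x j \<omega>) * iexp (Z \<omega>)"
        by (simp only: of_real_add distrib_left exp_add)
      moreover have "iexp (d \<bullet> x j \<omega>) = of_real (cos (d \<bullet> x j \<omega>)) + \<i> * of_real (sin (d \<bullet> x j \<omega>))"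
        by (simp only: exp_Euler cos_of_real sin_of_real)
      ultimately show ?thesis by (simp only: scaleR_conv_of_real of_real_mult) (simp add: algebra_simps)
    qed
    moreover have "(\<integral>\<omega>. (?W \<omega> * cos (d \<bullet> x j \<omega>)) *\<^sub>R iexp (Z \<omega>) \<partial>M) = 0"
      "integrable M (\<lambda>\<omega>. (?W \<omega> * cos (d \<bullet> x j \<omega>)) *\<^sub>R iexp (Z \<omega>))"
      by (rule real_case; simp)+
    moreover have "(\<integral>\<omega>. (?W \<omega> * sin (d \<bullet> x j \<omega>)) *\<^sub>R iexp (Z \<omega>) \<partial>M) = 0"
      "integrable M (\<lambda>\<omega>. (?W \<omega> * sin (d \<bullet> x j \<omega>)) *\<^sub>R iexp (Z \<omega>))"
      by (rule real_case; simp)+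
    ultimately show ?thesis
      by (simp only: split Bochner_Integration.integral_add integrable_mult_right
          integral_mult_right_zero mult_zero_right add_0_left)
  qed
  have defect: "(\<integral>\<omega>. indicator D \<omega> * ?W \<omega> \<partial>M) = 0"
    if D: "D \<in> sets (segment_algebra M x {j..N})" for D
  proof -
    have "(\<integral>\<omega>. indicator D \<omega> *\<^sub>R complex_of_real (?W \<omega>) \<partial>M) = 0"
      using W by (intro fourier_vanish_segment[OF _ _ _ char D]) (auto intro: x_measurable)
    then have "complex_of_real (\<integral>\<omega>. indicator D \<omega> * ?W \<omega> \<partial>M) = 0"
      by (simp add: scaleR_conv_of_real flip: of_real_mult integral_complex_of_real)
    then show ?thesis by simp
  qed
  have iB: "integrable M (indicator B :: 'w \<Rightarrow> real)" using BM by (simp add: emeasure_eq_measure)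
  note int = cond_defect_integrable[OF F AM iB]
  \<comment> \<open>An event \<open>C\<close> of the present met with \<open>B\<close> is an event
    of present and future, where \<open>defect\<close> applies.\<close>
  have "AE \<omega> in M. real_cond_exp M ?F (\<lambda>\<omega>. indicator B \<omega> * ?W \<omega>) \<omega> = 0"
  proof (rule F.real_cond_exp_charact)
    fix C assume C: "C \<in> sets ?F"
    have "C \<inter> B \<in> sets (segment_algebra M x {j..N})"
      by (intro sets.Int subsetD[OF sets_segment_algebra_mono C] subsetD[OF sets_segment_algebra_mono B])
         (use j in auto)
    from defect[OF this] show "(LINT \<omega>:C|M. indicator B \<omega> * ?W \<omega>) = (LINT \<omega>:C|M. 0)"
      by (simp add: set_lebesgue_integral_def indicator_inter_arith mult.assoc)
  qed (use int in auto)
  moreover have "AE \<omega> in M. real_cond_exp M ?F (\<lambda>\<omega>. ?p \<omega> * indicator B \<omega>) \<omega> =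
      ?p \<omega> * real_cond_exp M ?F (indicator B) \<omega>"
    using int(1) BM by (intro F.real_cond_exp_mult) (auto simp: mult.commute)
  moreover have "AE \<omega> in M. real_cond_exp M ?F (\<lambda>\<omega>. indicator B \<omega> * ?W \<omega> + ?p \<omega> * indicator B \<omega>) \<omega> =
      real_cond_exp M ?F (\<lambda>\<omega>. indicator B \<omega> * ?W \<omega>) \<omega> + real_cond_exp M ?F (\<lambda>\<omega>. ?p \<omega> * indicator B \<omega>) \<omega>"
    using int(1,3) by (intro F.real_cond_exp_add) (auto simp: mult.commute)
  \<comment> \<open>The intersection splits into a term with conditional expectation zero and one
    from which \<open>?p\<close> can be pulled out, which gives the factorisation.\<close>
  moreover have "(\<lambda>\<omega>. indicator B \<omega> * ?W \<omega> + ?p \<omega> * indicator B \<omega>) = (indicator (A \<inter> B) :: 'w \<Rightarrow> real)"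
    by (auto simp: fun_eq_iff cond_defect_def indicator_def algebra_simps)
  ultimately show "AE \<omega> in M. real_cond_exp M ?F (indicator (A \<inter> B)) \<omega> =
      ?p \<omega> * real_cond_exp M ?F (indicator B) \<omega>"
    by auto
qed

end

theorem corollary5p2:
  fixes M :: "'w measure" and N :: nat and x :: "nat \<Rightarrow> 'w \<Rightarrow> real^'d"
  assumes "prob_space M"
    and "gaussian_sequence M N x"
  shows "markov_sequence M N x \<longleftrightarrow>
    (\<forall>i j k. i < j \<and> j < k \<and> k \<le> N \<longrightarrow>
       covariance M (x k) (x i) =
       covariance M (x k) (x j) ** pinv (covariance M (x j) (x j)) ** covariance M (x j) (x i))"
proof -
  interpret gaussian_process M N x
    using assms by (simp add: gaussian_process_def gaussian_process_axioms_def)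
  show ?thesis
    using markov_imp_covariance covariance_imp_markov by blast
qed

end
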